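(* Let $\Gamma=(G,\sigma)$ be a signed graph. Then $\Gamma$ has a symmetric spectrum if and only if $$\sum_{C\in \mathcal{H}_1^+}(-2)^{p(C)}M(G-C, x)=\sum_{C\in \mathcal{H}_1^-}(-2)^{p(C)}M(G-C, x)$$ as polynomials in $x$.
   Context: Graphs are finite and simple. A signed graph $\Gamma=(G,\sigma)$ consists of a connected simple graph $G$ (the underlying graph) and a function $\sigma:E(G)\to\{+1,-1\}$. Its adjacency matrix $A(\Gamma)$ has $(u,v)$-entry $\sigma(uv)$ if $uv\in E(G)$ and $0$ otherwise. The spectrum of $\Gamma$ is the multiset of eigenvalues of $A(\Gamma)$; it is symmetric if for each eigenvalue $\lambda$ of $A(\Gamma)$, $-\lambda$ is also an eigenvalue with the same multiplicity. For a subgraph $\Gamma'$ of $\Gamma$, $\sigma(\Gamma')=\prod_{e\in E(\Gamma')}\sigma(e)$. A 2-regular subgraph $H$ of $G$ is a (nonempty) vertex-disjoint union of cycles of $G$; $|H|$ is its number of vertices and $p(H)$ its number of components. $\mathcal{H}_1$ is the set of 2-regular subgraphs $H$ with $|H|$ odd, $\mathcal{H}_1^+=\{H\in\mathcal{H}_1\mid\sigma(H)=1\}$ and $\mathcal{H}_1^-=\{H\in\mathcal{H}_1\mid\sigma(H)=-1\}$. $G-C$ is the subgraph of $G$ induced by $V(G)\setminus V(C)$. The matching polynomial of a graph $K$ on $n$ vertices is $M(K,x)=\sum_{i=0}^{m(K)}(-1)^i m_i(K)x^{n-2i}$, where $m(K)$ is the size of a largest matching and $m_i(K)$ is the number of matchings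 of $K$ with exactly $i$ edges ($m_0(K)=1$; for the graph with no vertices $M=1$). *)

theory Defs
  imports "Jordan_Normal_Form.Char_Poly"
begin

text \<open>A graph is a pair of a vertex set and a set of edges, an edge being the set of its two ends.\<close>

type_synonym 'a graph = "'a set \<times> 'a set set"

abbreviation verts :: "'a graph \<Rightarrow> 'a set" where "verts G \<equiv> fst G"
abbreviation edges :: "'a graph \<Rightarrow> 'a set set" where "edges G \<equiv> snd G"

definition simple_graph :: "'a graph \<Rightarrow> bool" where
  "simple_graph G \<longleftrightarrow> finite (verts G) \<and> (\<forall>e\<in>edges G. e \<subseteq> verts G \<and> card e = 2)"

definition reachability :: "'a graph \<Rightarrow> 'a rel" where
  "reachability G = {(u, v). {u, v} \<in> edges G}\<^sup>* \<inter> verts G \<times> verts G"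

definition connected_graph :: "'a graph \<Rightarrow> bool" where
  "connected_graph G \<longleftrightarrow> verts G \<noteq> {} \<and> (\<forall>u\<in>verts G. \<forall>v\<in>verts G. (u, v) \<in> reachability G)"

definition num_components :: "'a graph \<Rightarrow> nat" where
  "num_components G = card (verts G // reachability G)"

definition subgraph :: "'a graph \<Rightarrow> 'a graph \<Rightarrow> bool" where
  "subgraph H G \<longleftrightarrow> verts H \<subseteq> verts G \<and> edges H \<subseteq> edges G \<and> (\<forall>e\<in>edges H. e \<subseteq> verts H)"

definition induced_subgraph :: "'a graph \<Rightarrow> 'a set \<Rightarrow> 'a graph" where
  "induced_subgraph G W = (W, {e \<in> edges G. e \<subseteq> W})"

definition delete_verts_of :: "'a graph \<Rightarrow> 'a graph \<Rightarrow> 'a graph" where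
  "delete_verts_of G C = induced_subgraph G (verts G - verts C)"


definition is_cycle :: "'a graph \<Rightarrow> bool" where
  "is_cycle C \<longleftrightarrow> (\<exists>vs. distinct vs \<and> length vs \<ge> 3 \<and> verts C = set vs \<and>
     edges C = {{vs ! i, vs ! ((i + 1) mod length vs)} | i. i < length vs})"

definition two_regular_subgraph :: "'a graph \<Rightarrow> 'a graph \<Rightarrow> bool" where
  "two_regular_subgraph H G \<longleftrightarrow> (\<exists>\<C>. \<C> \<noteq> {} \<and>
     (\<forall>C\<in>\<C>. is_cycle C \<and> subgraph C G) \<and>
     pairwise (\<lambda>C D. disjnt (verts C) (verts D)) \<C> \<and>
     H = (\<Union>C\<in>\<C>. verts C, \<Union>C\<in>\<C>. edges C))"


text \<open>The values of \<^term>\<open>\<sigma>\<close> outside the edge set are irrelevant.\<close>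

definition signed_graph :: "'a graph \<Rightarrow> ('a set \<Rightarrow> real) \<Rightarrow> bool" where
  "signed_graph G \<sigma> \<longleftrightarrow> simple_graph G \<and> connected_graph G \<and> (\<forall>e\<in>edges G. \<sigma> e = 1 \<or> \<sigma> e = -1)"

definition graph_sign :: "('a set \<Rightarrow> real) \<Rightarrow> 'a graph \<Rightarrow> real" where
  "graph_sign \<sigma> H = (\<Prod>e\<in>edges H. \<sigma> e)"

definition odd_two_regular :: "'a graph \<Rightarrow> 'a graph set" where
  "odd_two_regular G = {H. two_regular_subgraph H G \<and> odd (card (verts H))}"

definition pos_odd_two_regular :: "'a graph \<Rightarrow> ('a set \<Rightarrow> real) \<Rightarrow> 'a graph set" where
  "pos_odd_two_regular G \<sigma> = {H \<in> odd_two_regular G. graph_sign \<sigma> H = 1}"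

definition neg_odd_two_regular :: "'a graph \<Rightarrow> ('a set \<Rightarrow> real) \<Rightarrow> 'a graph set" where
  "neg_odd_two_regular G \<sigma> = {H \<in> odd_two_regular G. graph_sign \<sigma> H = -1}"


text \<open>Matrices are indexed by numbers, so the adjacency matrix is taken with respect to an
  enumeration \<^term>\<open>vs\<close> of the vertices.\<close>

definition adj_matrix :: "'a graph \<Rightarrow> ('a set \<Rightarrow> real) \<Rightarrow> 'a list \<Rightarrow> real mat" where
  "adj_matrix G \<sigma> vs = mat (length vs) (length vs)
     (\<lambda>(i, j). if {vs ! i, vs ! j} \<in> edges G then \<sigma> {vs ! i, vs ! j} else 0)"

text \<open>Multiplicity is the algebraic one; it agrees with the geometric one for the symmetric matrices
  considered here, whose eigenvalues are all real.\<close>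

definition symmetric_spectrum :: "real mat \<Rightarrow> bool" where
  "symmetric_spectrum A \<longleftrightarrow> (\<forall>l. eigenvalue A l \<longrightarrow>
     eigenvalue A (- l) \<and> Polynomial.order (- l) (char_poly A) = Polynomial.order l (char_poly A))"


definition matchings :: "'a graph \<Rightarrow> 'a set set set" where
  "matchings G = {M. M \<subseteq> edges G \<and> pairwise disjnt M}"

definition num_matchings :: "'a graph \<Rightarrow> nat \<Rightarrow> nat" where
  "num_matchings G i = card {M \<in> matchings G. card M = i}"

definition matching_number :: "'a graph \<Rightarrow> nat" where
  "matching_number G = Max (card ` matchings G)"

text \<open>The truncated subtraction is exact: a matching with \<^term>\<open>i\<close> edges covers
  \<^term>\<open>2 * i\<close> vertices.\<close>

definition matching_poly :: "'a graph \<Rightarrow> real poly" where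
  "matching_poly G = (\<Sum>i = 0..matching_number G.
     Polynomial.monom ((-1) ^ i * real (num_matchings G i)) (card (verts G) - 2 * i))"

end

theory Submission
  imports Defs "HOL-Combinatorics.Orbits" "HOL-Combinatorics.Cycles"
begin

text \<open>
  Expand $\<Phi>(x) = \det(x I - A)$ over permutations. A cycle of length at least 3 of a contributing permutation
  traverses a cycle $C$ of the graph in one of two directions and carries the factor $-\<sigma>(C)$, a transposition
  is an edge with factor $-1$, and a fixed point has factor $x$. Hence the characteristic polynomial is
  $\<Phi>(x) = \<Sum>_H (-2)^{p(H)} \<sigma>(H) M(G - H, x)$, where $H$ runs over all disjoint unions of cycles, including
  the empty one. This identity is proved by induction on the vertex set, since both sides obey the same recurrence
  obtained by removing the orbit of a chosen vertex.

  As $A$ is symmetric, $\<Phi>$ splits over the reals, so the spectrum is symmetric iff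
  $\<Phi>(-x) = (-1)^n \<Phi>(x)$. By the parity of matching polynomials the terms with $|H|$ even always satisfy this
  equation, and those with $|H|$ odd satisfy its negative, so the condition says that the odd terms sum to 0.
\<close>

section \<open>Cyclic permutations and the determinant expansion\<close>

text \<open>The determinant of \<open>B\<close> with rows and columns in \<open>W\<close>, indexed
  by the set itself so that vertices can be removed without renumbering.\<close>

definition perm_sum :: "('a \<Rightarrow> 'a \<Rightarrow> 'b::comm_ring_1) \<Rightarrow> 'a set \<Rightarrow> 'b" where
  "perm_sum B W = (\<Sum>p | p permutes W. of_int (sign p) * (\<Prod>u\<in>W. B u (p u)))"

text \<open>A permutation is determined by its restriction to the orbit of \<^term>\<open>v\<close>, which is a member of the
  following set, and its restriction to the remaining points.\<close>

definition cycles_at :: "'a \<Rightarrow> 'a set \<Rightarrow> ('a \<Rightarrow> 'a) set" where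
  "cycles_at v W = {c. c permutes orbit c v \<and> orbit c v \<subseteq> W}"

lemma finite_cycles_at: "finite W \<Longrightarrow> finite (cycles_at v W)"
  by (rule finite_subset[OF _ finite_permutations[of W]]) (auto simp: cycles_at_def intro: permutes_subset)

text \<open>An injective self-map of a finite set is onto, so \<open>p\<close> permutes each of its
  orbits.\<close>

lemma perm_restrict_orbit_permutes:
  assumes "p permutes W" "finite W"
  shows "perm_restrict p (orbit p v) permutes orbit p v"
proof -
  have "p ` orbit p v \<subseteq> orbit p v" by (auto intro: orbit.step)
  moreover have "finite (orbit p v)"
    using assms by (meson finite_orbit permutation_permutes permutation_self_in_orbit)
  moreover have "inj_on p (orbit p v)" using assms(1) by (meson inj_on_subset permutes_inj subset_UNIV)
  ultimately have "bij_betw p (orbit p v) (orbit p v)"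
    by (simp add: bij_betw_def endo_inj_surj)
  then have "bij_betw (perm_restrict p (orbit p v)) (orbit p v) (orbit p v)"
    by (subst bij_betw_cong[where g=p]) (auto simp: perm_restrict_simps)
  then show ?thesis by (rule bij_imp_permutes) (simp add: perm_restrict_simps)
qed

text \<open>Every permutation of \<open>W\<close> is in a unique way a composition
  \<open>c \<circ> q\<close> of a cyclic part \<open>c\<close> on the orbit of \<open>v\<close> and
  a permutation \<open>q\<close> of the remaining points. Sign and product of entries are
  multiplicative along this factorization.\<close>

lemma perm_sum_orbit:
  assumes W: "finite W" and v: "v \<in> W"
  shows "perm_sum B W = (\<Sum>c\<in>cycles_at v W.
    of_int (sign c) * (\<Prod>u\<in>orbit c v. B u (c u)) * perm_sum B (W - orbit c v))"
proof -
  define h where "h c q = of_int (sign c) * (\<Prod>u\<in>orbit c v. B u (c u)) *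
      (of_int (sign q) * (\<Prod>u\<in>W - orbit c v. B u (q u)))" for c q
  \<comment> \<open>Together, \<open>comp\<close> and \<open>decomp\<close> say that composing and
    restricting are mutually inverse.\<close>
  have comp: "(c \<circ> q) permutes W \<and> orbit (c \<circ> q) v = orbit c v \<and>
      perm_restrict (c \<circ> q) (orbit c v) = c \<and> perm_restrict (c \<circ> q) (W - orbit c v) = q"
    if c: "c \<in> cycles_at v W" and q: "q permutes (W - orbit c v)" for c q
  proof (intro conjI)
    have cO: "c permutes orbit c v" "orbit c v \<subseteq> W" using c by (auto simp: cycles_at_def)
    have "permutation c" using cO W by (meson finite_subset permutation_permutes)
    note vO = permutation_self_in_orbit[OF this, of v]
    show "(c \<circ> q) permutes W"
      using cO q by (intro permutes_compose) (auto intro: permutes_subset)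
    have qid: "q x = x" if "x \<in> orbit c v" for x using q that by (simp add: permutes_not_in)
    have cid: "c x = x" if "x \<notin> orbit c v" for x using cO that by (simp add: permutes_not_in)
    show "orbit (c \<circ> q) v = orbit c v" by (rule orbit_cong[OF vO]) (simp add: qid)
    show "perm_restrict (c \<circ> q) (orbit c v) = c"
      by (auto simp: perm_restrict_def fun_eq_iff qid cid)
    show "perm_restrict (c \<circ> q) (W - orbit c v) = q"
    proof
      fix x show "perm_restrict (c \<circ> q) (W - orbit c v) x = q x"
        using permutes_in_image[OF q, of x] permutes_not_in[OF q, of x]
        by (auto simp: perm_restrict_def cid)
    qed
  qed
  have decomp: "perm_restrict p (orbit p v) \<in> cycles_at v W \<and> orbit (perm_restrict p (orbit p v)) v = orbit p v \<and>
      perm_restrict p (W - orbit p v) permutes (W - orbit p v) \<and>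
      perm_restrict p (orbit p v) \<circ> perm_restrict p (W - orbit p v) = p" if p: "p permutes W" for p
  proof -
    have sub: "orbit p v \<subseteq> W" by (rule permutes_orbit_subset[OF p v])
    have perm: "permutation p" using p W by (meson permutation_permutes)
    have o: "orbit (perm_restrict p (orbit p v)) v = orbit p v"
      by (rule orbit_cong[OF permutation_self_in_orbit[OF perm]]) (simp add: perm_restrict_simps)
    have r1: "perm_restrict p (orbit p v) permutes orbit p v"
      by (rule perm_restrict_orbit_permutes[OF p W])
    have r2: "perm_restrict p (W - orbit p v) permutes (W - orbit p v)"
      by (rule perm_restrict_diff_cyclic[OF p cyclic_on_orbit[OF p W]])
    have "perm_restrict p (orbit p v) \<circ> perm_restrict p (W - orbit p v) = perm_restrict p (orbit p v \<union> (W - orbit p v))"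
      by (rule perm_restrict_union[OF r1 r2]) auto
    also have "orbit p v \<union> (W - orbit p v) = W" using sub by auto
    also have "perm_restrict p W = p" using p by simp
    finally show ?thesis using o r1 r2 sub by (auto simp: cycles_at_def o_def)
  qed
  have "perm_sum B W = (\<Sum>(c, q)\<in>(SIGMA c:cycles_at v W. {q. q permutes (W - orbit c v)}). h c q)"
    unfolding perm_sum_def
  proof (rule sum.reindex_bij_witness[where j = "\<lambda>p. (perm_restrict p (orbit p v), perm_restrict p (W - orbit p v))"
        and i = "\<lambda>(c, q). c \<circ> q"], goal_cases)
    case (5 p)
    then have p: "p permutes W" by simp
    have sub: "orbit p v \<subseteq> W" by (rule permutes_orbit_subset[OF p v])
    define c where "c = perm_restrict p (orbit p v)"
    define q where "q = perm_restrict p (W - orbit p v)"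
    note d = decomp[OF p, folded c_def q_def]
    have pc: "permutation c" using d W unfolding cycles_at_def
      by (metis (no_types, lifting) finite_subset mem_Collect_eq permutation_permutes)
    have pq: "permutation q" using d W by (metis finite_Diff permutation_permutes)
    have "sign p = sign c * sign q" using d sign_compose[OF pc pq] by metis
    moreover have "(\<Prod>u\<in>W. B u (p u)) = (\<Prod>u\<in>orbit p v. B u (p u)) * (\<Prod>u\<in>W - orbit p v. B u (p u))"
      using prod.subset_diff[OF sub W, of "\<lambda>u. B u (p u)"] by (simp add: mult.commute)
    moreover have "(\<Prod>u\<in>orbit p v. B u (p u)) = (\<Prod>u\<in>orbit c v. B u (c u))"
      using d by (intro prod.cong) (auto simp: c_def perm_restrict_simps)
    moreover have "(\<Prod>u\<in>W - orbit p v. B u (p u)) = (\<Prod>u\<in>W - orbit c v. B u (q u))"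
      using d by (intro prod.cong) (auto simp: q_def perm_restrict_simps)
    ultimately show ?case by (simp add: h_def c_def[symmetric] q_def[symmetric] mult_ac)
  qed (use decomp comp in auto)
  also have "\<dots> = (\<Sum>c\<in>cycles_at v W. \<Sum>q | q permutes (W - orbit c v). h c q)"
    by (rule sum.Sigma[symmetric]) (use W in \<open>auto simp: finite_cycles_at finite_permutations\<close>)
  finally show ?thesis by (simp add: h_def perm_sum_def sum_distrib_left)
qed

section \<open>Cyclic permutations written as lists\<close>

lemma sign_cycle_of_list:
  "distinct cs \<Longrightarrow> sign (cycle_of_list cs) = (-1) ^ (length cs - 1)"
proof (induction cs rule: cycle_of_list.induct)
  \<comment> \<open>The recursion of \<open>cycle_of_list\<close> splits off one transposition per
    list element but the last, and each contributes -1.\<close>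
  case (1 i j cs)
  then show ?case
    using sign_compose[OF permutation_swap_id[of i j] permutation_of_cycle[of "j # cs"]]
    by (simp add: sign_swap_id o_def)
qed auto

lemma cycle_of_list_nth:
  assumes "distinct cs" "i < length cs"
  shows "cycle_of_list cs (cs ! i) = cs ! ((i + 1) mod length cs)"
proof -
  have "map (cycle_of_list cs) cs = rotate1 cs" using cyclic_rotation[OF assms(1), of 1] by simp
  then have "map (cycle_of_list cs) cs ! i = rotate1 cs ! i" by simp
  then show ?thesis using assms by (simp add: nth_rotate1)
qed

lemma set_support_eq_orbit: "permutation c \<Longrightarrow> set (support c v) = orbit c v"
  by (subst support_set) (auto simp: orbit_altdef_permutation)

lemma cycle_of_list_support:
  assumes "permutation c" "c permutes orbit c v"
  shows "cycle_of_list (support c v) = c"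
proof
  fix x show "cycle_of_list (support c v) x = c x"
  proof (cases "x \<in> orbit c v")
    case True
    then show ?thesis using cycle_restrict[OF assms(1), of x v] set_support_eq_orbit[OF assms(1)] by simp
  next
    case False
    then show ?thesis
      using set_support_eq_orbit[OF assms(1)] assms(2) by (metis id_outside_supp permutes_not_in)
  qed
qed

lemma sign_cyclic_permutation:
  assumes "permutation c" "c permutes orbit c v"
  shows "sign c = (-1) ^ (card (orbit c v) - 1)"
  using sign_cycle_of_list[OF cycle_of_permutation[OF assms(1), of v]]
    cycle_of_list_support[OF assms] set_support_eq_orbit[OF assms(1), of v]
    distinct_card[OF cycle_of_permutation[OF assms(1), of v]] by simp

section \<open>Graph cycles and the cyclic permutations that trace them\<close>

definition cycle_graph :: "('a \<Rightarrow> 'a) \<Rightarrow> 'a \<Rightarrow> 'a graph" where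
  "cycle_graph c v = (orbit c v, (\<lambda>u. {u, c u}) ` orbit c v)"

text \<open>The successor map \<open>cycle_of_list\<close> replaces index arithmetic modulo the
  length, so that graph cycles can be compared with orbits of permutations.\<close>

lemma is_cycle_iff_cycle_of_list:
  "is_cycle C \<longleftrightarrow> (\<exists>cs. distinct cs \<and> length cs \<ge> 3 \<and>
    C = (set cs, (\<lambda>u. {u, cycle_of_list cs u}) ` set cs))"
proof -
  have *: "(\<lambda>u. {u, cycle_of_list cs u}) ` set cs = {{cs ! i, cs ! ((i + 1) mod length cs)} | i. i < length cs}"
    if "distinct cs" for cs :: "'a list"
    unfolding set_conv_nth[of cs] using cycle_of_list_nth[OF that] by auto
  show ?thesis unfolding is_cycle_def
  proof (rule ex_cong1)
    fix cs
    show "(distinct cs \<and> 3 \<le> length cs \<and> verts C = set cs \<and>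
        edges C = {{cs ! i, cs ! ((i + 1) mod length cs)} |i. i < length cs}) \<longleftrightarrow>
      (distinct cs \<and> 3 \<le> length cs \<and> C = (set cs, (\<lambda>u. {u, cycle_of_list cs u}) ` set cs))"
    proof (cases "distinct cs")
      case True
      show ?thesis unfolding *[OF True] prod_eq_iff by (simp only: fst_conv snd_conv)
    qed simp
  qed
qed

text \<open>The witness \<open>support c v\<close> lists \<open>v\<close>, \<open>c v\<close>,
  \<open>c (c v)\<close> and so on, once around the orbit.\<close>

lemma is_cycle_cycle_graph:
  assumes "permutation c" "c permutes orbit c v" "card (orbit c v) \<ge> 3"
  shows "is_cycle (cycle_graph c v)"
  unfolding is_cycle_iff_cycle_of_list cycle_graph_def
  using cycle_of_permutation[OF assms(1), of v] cycle_of_list_support[OF assms(1,2)] 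
   set_support_eq_orbit[OF assms(1), of v] assms(3) distinct_card[OF cycle_of_permutation[OF assms(1), of v]]
  by (intro exI[of _ "support c v"]) simp

lemma cycle_of_list_funpow_nth:
  assumes "distinct cs" "cs \<noteq> []" "i < length cs"
  shows "(cycle_of_list cs ^^ n) (cs ! i) = cs ! ((i + n) mod length cs)"
proof (induction n)
  case (Suc n)
  then show ?case using cycle_of_list_nth[OF assms(1), of "(i + n) mod length cs"] assms
    by (simp add: mod_Suc_eq)
qed (use assms in simp)

lemma orbit_cycle_of_list:
  assumes "distinct cs" "v \<in> set cs"
  shows "orbit (cycle_of_list cs) v = set cs"
proof
  show "orbit (cycle_of_list cs) v \<subseteq> set cs"
    by (rule permutes_orbit_subset[OF cycle_permutes assms(2)])
  obtain i where i: "i < length cs" "v = cs ! i" using assms(2) by (metis in_set_conv_nth)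
  show "set cs \<subseteq> orbit (cycle_of_list cs) v"
  proof
    fix w assume "w \<in> set cs"
    then obtain j where j: "j < length cs" "w = cs ! j" by (metis in_set_conv_nth)
    \<comment> \<open>The exponent leads from position \<open>i\<close> past the end of the list and
      on to position \<open>j\<close>; it is positive, as membership in an orbit requires.\<close>
    have "(cycle_of_list cs ^^ (length cs - i + j)) v = cs ! ((i + (length cs - i + j)) mod length cs)"
      unfolding i(2) by (rule cycle_of_list_funpow_nth) (use assms i in auto)
    also have "\<dots> = w" using i j by simp
    finally show "w \<in> orbit (cycle_of_list cs) v"
      using i(1) unfolding orbit_altdef by (auto intro!: exI[of _ "length cs - i + j"])
  qed
qed

text \<open>If \<open>c\<close> returned to \<open>u\<close> after two steps, the orbit would be
  contained in \<open>{u, c u}\<close>.\<close>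

lemma cyclic_permutation_no_two_cycle:
  assumes c: "permutation c" and card: "card (orbit c v) \<ge> 3" and u: "u \<in> orbit c v"
  shows "c (c u) \<noteq> u"
proof
  assume *: "c (c u) = u"
  have "orbit c v = orbit c u" using u cyclic_on_orbit'[OF c, of v] by (simp add: orbit_cyclic_eq3)
  also have "\<dots> = {(c ^^ m) u |m. m < 2}" by (rule orbit_altdef_bounded) (use * in \<open>simp_all add: numeral_2_eq_2\<close>)
  also have "\<dots> \<subseteq> {u, c u}" by (auto simp: less_2_cases_iff)
  finally have "card (orbit c v) \<le> card {u, c u}" by (intro card_mono) auto
  also have "\<dots> \<le> 2" by (simp add: card_insert_if)
  finally show False using card by simp
qed

text \<open>The image of a vertex under a cyclic permutation with a given cycle graph is one of its two neighbours;
  once it is chosen at one vertex, it is forced along the whole orbit.\<close>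

lemma cyclic_permutation_determined:
  assumes c: "permutation c" "c permutes orbit c v" and d: "permutation d" "d permutes orbit d v"
    and eq: "cycle_graph c v = cycle_graph d v" and card: "card (orbit c v) \<ge> 3" and v: "c v = d v"
  shows "c = d"
proof -
  have O: "orbit c v = orbit d v" using eq by (simp add: cycle_graph_def)
  have inv: "w = d u \<or> u = d w" if "u \<in> orbit c v" "w = c u" for u w
  proof -
    have "{u, w} \<in> (\<lambda>u. {u, d u}) ` orbit d v" using eq that by (auto simp: cycle_graph_def)
    then show ?thesis by (auto simp: doubleton_eq_iff)
  qed
  note no2 = cyclic_permutation_no_two_cycle[OF c(1) card]
  have pow: "c ((c ^^ n) v) = d ((c ^^ n) v) \<and> (c ^^ n) v \<in> orbit c v" for n
  proof (induction n)
    case 0 show ?case using v permutation_self_in_orbit[OF c(1)] by simp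
  next
    case (Suc n)
    let ?u = "(c ^^ n) v"
    have u: "c ?u = d ?u" "?u \<in> orbit c v" using Suc by auto
    have cu: "c ?u \<in> orbit c v" using u(2) by (rule orbit.step)
    have "c (c ?u) = d (c ?u) \<or> c ?u = d (c (c ?u))" using inv[OF cu] by auto
    moreover have "c ?u \<noteq> d (c (c ?u))"
    proof
      assume "c ?u = d (c (c ?u))"
      then have "d ?u = d (c (c ?u))" using u by simp
      then have uc: "?u = c (c ?u)" using d(1) by (metis permutation_bijective bij_is_inj injD)
      then show False using no2[OF u(2)] by simp
    qed
    ultimately show ?case using cu by simp
  qed
  show ?thesis
  proof
    fix x show "c x = d x"
    proof (cases "x \<in> orbit c v")
      case True
      then obtain n where "x = (c ^^ n) v" using c(1) by (auto simp: orbit_altdef_permutation)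
      then show ?thesis using pow by simp
    next
      case False then show ?thesis using c(2) d(2) O by (simp add: permutes_not_in)
    qed
  qed
qed

text \<open>The two permutations are the two directions around \<open>C\<close>, some
  \<open>c\<close> and its inverse; they differ because \<open>c\<close> has no 2-cycle. This is the
  source of the factor 2 in the weight of a cycle.\<close>

lemma card_cyclic_permutations_of_cycle:
  assumes C: "is_cycle C" and v: "v \<in> verts C"
  shows "card {c. permutation c \<and> c permutes orbit c v \<and> cycle_graph c v = C} = 2"
proof -
  obtain cs where cs: "distinct cs" "length cs \<ge> 3"
    and Ceq: "C = (set cs, (\<lambda>u. {u, cycle_of_list cs u}) ` set cs)"
    using C by (auto simp: is_cycle_iff_cycle_of_list)
  define c where "c = cycle_of_list cs"
  have O: "orbit c v = set cs" unfolding c_def using orbit_cycle_of_list[OF cs(1)] v Ceq by simp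
  have perm: "permutation c" unfolding c_def by (rule permutation_of_cycle)
  have c: "c permutes orbit c v" unfolding O unfolding c_def by (rule cycle_permutes)
  have gc: "cycle_graph c v = C" unfolding cycle_graph_def O Ceq by (simp add: c_def)
  have card: "card (orbit c v) \<ge> 3" using O cs distinct_card[OF cs(1)] by simp
  have Oi: "orbit (Hilbert_Choice.inv c) v = orbit c v" by (rule orbit_inv_eq[OF perm])
  have permi: "permutation (Hilbert_Choice.inv c)" by (rule permutation_inverse[OF perm])
  have ci: "Hilbert_Choice.inv c permutes orbit (Hilbert_Choice.inv c) v" unfolding Oi by (rule permutes_inv[OF c])
  \<comment> \<open>Shifting the index by \<open>c\<close> turns the edges
    \<open>{u, inv c u}\<close> into \<open>{c u, u}\<close>, so both directions have the same
    edges.\<close>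
  have "(\<lambda>u. {u, Hilbert_Choice.inv c u}) ` orbit c v = (\<lambda>u. {u, Hilbert_Choice.inv c u}) ` (c ` orbit c v)"
    using permutes_image[OF c] by simp
  also have "\<dots> = (\<lambda>u. {u, c u}) ` orbit c v"
    unfolding image_image using permutes_inverses(2)[OF c] by (simp add: insert_commute)
  finally have gi: "cycle_graph (Hilbert_Choice.inv c) v = C" using gc by (simp add: cycle_graph_def Oi)
  have vO: "v \<in> orbit c v" by (rule permutation_self_in_orbit[OF perm])
  have "c \<noteq> Hilbert_Choice.inv c"
    using cyclic_permutation_no_two_cycle[OF perm card vO] permutes_inverses(1)[OF c] by metis
  moreover have "{c. permutation c \<and> c permutes orbit c v \<and> cycle_graph c v = C} = {c, Hilbert_Choice.inv c}"
  proof (intro equalityI subsetI)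
    fix d assume "d \<in> {c. permutation c \<and> c permutes orbit c v \<and> cycle_graph c v = C}"
    then have d: "permutation d" "d permutes orbit d v" "cycle_graph d v = C" by auto
    have Od: "orbit d v = orbit c v" using d(3) gc by (metis cycle_graph_def prod.inject)
    \<comment> \<open>The vertex \<open>d v\<close> is one of the two neighbours of \<open>v\<close>
      on the cycle, and this choice fixes the direction.\<close>
    have "{v, d v} \<in> (\<lambda>u. {u, c u}) ` orbit c v"
      using d(3) gc vO Od by (auto simp: cycle_graph_def)
    then have "d v = c v \<or> d v = Hilbert_Choice.inv c v"
      using permutes_inverses(2)[OF c] by (auto simp: doubleton_eq_iff)
    then show "d \<in> {c, Hilbert_Choice.inv c}"
      using cyclic_permutation_determined[OF d(1,2) perm c] cyclic_permutation_determined[OF d(1,2) permi ci]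
        d(3) gc gi card Od by auto
  qed (use perm c gc permi ci gi in auto)
  ultimately show ?thesis by simp
qed

lemma orbit_id: "orbit id v = {v}"
  by (simp add: orbit_eq_singleton_iff)

lemma orbit_transpose: "orbit (transpose v u) v = {v, u}"
proof -
  have "orbit (transpose v u) v = {(transpose v u ^^ m) v | m. m < 2}"
    by (rule orbit_altdef_bounded) (simp_all add: numeral_2_eq_2)
  also have "\<dots> = {v, u}" by (auto simp: less_2_cases_iff intro: exI[of _ 0] exI[of _ 1])
  finally show ?thesis .
qed

text \<open>The cases are an orbit of \<open>v\<close> with one, two or at least three points. They
  account for a free vertex, a matching edge and a graph cycle.\<close>

lemma cycles_at_split:
  assumes W: "finite W" and v: "v \<in> W"
  shows "cycles_at v W = insert id (transpose v ` (W - {v}) \<union> {c \<in> cycles_at v W. card (orbit c v) \<ge> 3})"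
    (is "_ = ?R")
proof
  show "?R \<subseteq> cycles_at v W"
    using v by (auto simp: cycles_at_def orbit_id orbit_transpose permutes_id intro: permutes_swap_id)
  show "cycles_at v W \<subseteq> ?R"
  proof
    fix c assume c: "c \<in> cycles_at v W"
    then have cO: "c permutes orbit c v" "orbit c v \<subseteq> W" by (auto simp: cycles_at_def)
    have fin: "finite (orbit c v)" using cO W finite_subset by blast
    have "permutation c" using cO fin by (meson permutation_permutes)
    then have vO: "v \<in> orbit c v" by (rule permutation_self_in_orbit)
    show "c \<in> ?R"
    proof (cases "card (orbit c v) \<ge> 3")
      case False
      have sub: "orbit c v = {v, c v}"
      proof -
        have "{v, c v} \<subseteq> orbit c v" using vO orbit.base by fast
        moreover have "card {v, c v} = card (orbit c v)" if "c v \<noteq> v"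
        proof -
          have "card {v, c v} = 2" using that by simp
          moreover have "card {v, c v} \<le> card (orbit c v)" using \<open>{v, c v} \<subseteq> orbit c v\<close> fin by (rule card_mono[rotated])
          ultimately show ?thesis using False by simp
        qed
        ultimately show ?thesis
          using fin orbit_eq_singleton_iff[of c v] card_subset_eq[of "orbit c v" "{v, c v}"]
          by (cases "c v = v") auto
      qed
      \<comment> \<open>This also covers \<open>c v = v\<close>, where the transposition is the
        identity; otherwise injectivity forces \<open>c (c v) = v\<close>.\<close>
      have "c = transpose v (c v)"
      proof
        fix x
        have "c (c v) \<in> {v, c v}" using sub orbit.step[OF orbit.base, of c v] by simp
        moreover have "c (c v) = c v \<Longrightarrow> c v = v" using permutes_inj[OF cO(1)] by (meson injD)
        ultimately have "c (c v) = v" by auto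
        then show "c x = transpose v (c v) x"
          using permutes_not_in[OF cO(1), of x] sub by (auto simp: transpose_def)
      qed
      moreover have "c v \<in> W" using sub cO by auto
      ultimately show ?thesis by (cases "c v = v") auto
    qed (use c in auto)
  qed
qed

section \<open>Recurrence for the determinant of \<open>x I - A\<close>\<close>

definition cycles_in :: "'a graph \<Rightarrow> 'a set \<Rightarrow> 'a graph set" where
  "cycles_in G W = {C. is_cycle C \<and> subgraph C G \<and> verts C \<subseteq> W}"

definition adj :: "'a graph \<Rightarrow> ('a set \<Rightarrow> real) \<Rightarrow> 'a \<Rightarrow> 'a \<Rightarrow> real" where
  "adj G \<sigma> u w = (if {u, w} \<in> edges G then \<sigma> {u, w} else 0)"

text \<open>The entries of \<open>x I - A\<close> as polynomials in \<open>x\<close>; the diagonal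
  of \<open>A\<close> is zero in a graph without loops.\<close>

definition char_entry :: "'a graph \<Rightarrow> ('a set \<Rightarrow> real) \<Rightarrow> 'a \<Rightarrow> 'a \<Rightarrow> real poly" where
  "char_entry G \<sigma> u w = (if u = w then [:0, 1:] else [:- adj G \<sigma> u w:])"

lemma finite_edges: "simple_graph G \<Longrightarrow> finite (edges G)"
  by (rule finite_subset[of _ "Pow (verts G)"]) (auto simp: simple_graph_def)

lemma finite_cycles_in: "simple_graph G \<Longrightarrow> finite (cycles_in G W)"
  by (rule finite_subset[of _ "Pow (verts G) \<times> Pow (edges G)"])
    (auto simp: simple_graph_def finite_edges cycles_in_def subgraph_def)

text \<open>A missing edge makes a factor vanish. Otherwise distinct \<open>u\<close> give distinct
  edges \<open>{u, c u}\<close>, as \<open>c\<close> has no 2-cycle on the orbit, so the product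
  over vertices is a product over edges.\<close>

lemma prod_adj_cyclic:
  assumes c: "permutation c" and card: "card (orbit c v) \<ge> 3"
  shows "(\<Prod>u\<in>orbit c v. adj G \<sigma> u (c u)) =
    (if edges (cycle_graph c v) \<subseteq> edges G then graph_sign \<sigma> (cycle_graph c v) else 0)"
proof (cases "edges (cycle_graph c v) \<subseteq> edges G")
  case True
  have "inj_on (\<lambda>u. {u, c u}) (orbit c v)"
  proof (rule inj_onI)
    fix u w assume "u \<in> orbit c v" "{u, c u} = {w, c w}"
    then show "u = w"
      using cyclic_permutation_no_two_cycle[OF c card, of u] unfolding doubleton_eq_iff by auto
  qed
  then have "graph_sign \<sigma> (cycle_graph c v) = (\<Prod>u\<in>orbit c v. \<sigma> {u, c u})"
    by (simp add: graph_sign_def cycle_graph_def prod.reindex)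
  also have "\<dots> = (\<Prod>u\<in>orbit c v. adj G \<sigma> u (c u))"
    using True by (intro prod.cong) (auto simp: adj_def cycle_graph_def)
  finally show ?thesis using True by simp
next
  case False
  then obtain u where "u \<in> orbit c v" "{u, c u} \<notin> edges G" by (auto simp: cycle_graph_def)
  moreover have "finite (orbit c v)" using card card.infinite by fastforce
  ultimately have "(\<Prod>u\<in>orbit c v. adj G \<sigma> u (c u)) = 0"
    by (intro prod_zero) (auto simp: adj_def)
  then show ?thesis using False by simp
qed

lemma prod_pCons_0: "(\<Prod>x\<in>A. [:f x:]) = [:\<Prod>x\<in>A. f x :: 'b::comm_semiring_1:]"
  by (induction A rule: infinite_finite_induct) (auto simp: one_pCons mult.commute)

text \<open>The orbit expansion at \<open>v\<close>, sorted by orbit size. A fixed point gives the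
  factor \<open>x\<close>, a transposition gives -1, and a longer orbit gives
  \<open>-\<sigma>(C)\<close> once for each direction around \<open>C\<close>.\<close>

lemma perm_sum_rec:
  assumes G: "simple_graph G" and sgn: "\<forall>e\<in>edges G. \<sigma> e = 1 \<or> \<sigma> e = -1"
    and W: "W \<subseteq> verts G" and v: "v \<in> W"
  defines "F \<equiv> perm_sum (char_entry G \<sigma>)"
  shows "F W = [:0, 1:] * F (W - {v}) - (\<Sum>u\<in>{u \<in> W. {v, u} \<in> edges G}. F (W - {v, u}))
     + (\<Sum>C\<in>{C \<in> cycles_in G W. v \<in> verts C}. Polynomial.smult (- 2 * graph_sign \<sigma> C) (F (W - verts C)))"
proof -
  have finW: "finite W" using G W finite_subset by (auto simp: simple_graph_def)
  define L where "L = {c \<in> cycles_at v W. card (orbit c v) \<ge> 3}"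
  define t where "t c = of_int (sign c) * (\<Prod>u\<in>orbit c v. char_entry G \<sigma> u (c u)) * F (W - orbit c v)" for c
  define T where "T = {C \<in> cycles_in G W. v \<in> verts C}"
  have noloop: "{v} \<notin> edges G" using G by (auto simp: simple_graph_def)
  have Lperm: "permutation c \<and> c permutes orbit c v \<and> card (orbit c v) \<ge> 3 \<and> orbit c v \<subseteq> W" if "c \<in> L" for c
  proof -
    have "c permutes orbit c v \<and> card (orbit c v) \<ge> 3 \<and> orbit c v \<subseteq> W"
      using that by (auto simp: L_def cycles_at_def)
    then show ?thesis using finW by (meson finite_subset permutation_permutes)
  qed
  have "F W = sum t (cycles_at v W)"
    unfolding F_def t_def by (rule perm_sum_orbit[OF finW v])
  also have "\<dots> = sum t (insert id (transpose v ` (W - {v}) \<union> L))"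
    using cycles_at_split[OF finW v] by (simp add: L_def)
  also have "\<dots> = t id + sum t (transpose v ` (W - {v}) \<union> L)"
  proof (rule sum.insert)
    show "finite (transpose v ` (W - {v}) \<union> L)" using finW finite_cycles_at[OF finW] by (simp add: L_def)
    have "transpose v u \<noteq> id" if "u \<noteq> v" for u using that by (metis id_apply transpose_apply_first)
    then show "id \<notin> transpose v ` (W - {v}) \<union> L" by (auto simp: L_def orbit_id image_iff dest: sym)
  qed
  also have "sum t (transpose v ` (W - {v}) \<union> L) = sum t (transpose v ` (W - {v})) + sum t L"
  proof (rule sum.union_disjoint)
    show "finite L" using finite_cycles_at[OF finW] by (simp add: L_def)
    show "transpose v ` (W - {v}) \<inter> L = {}" by (auto simp: L_def orbit_transpose card_insert_if split: if_splits)
  qed (use finW in auto)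
  also have "t id = [:0, 1:] * F (W - {v})" by (simp add: t_def orbit_id char_entry_def)
  also have "sum t (transpose v ` (W - {v})) = (\<Sum>u\<in>W - {v}. t (transpose v u))"
    by (rule sum.reindex[unfolded o_def]) (metis inj_onI transpose_apply_first)
  also have "\<dots> = (\<Sum>u\<in>W - {v}. if {v, u} \<in> edges G then - F (W - {v, u}) else 0)"
  proof (rule sum.cong[OF refl])
    fix u assume u: "u \<in> W - {v}"
    have "(\<Prod>w\<in>{v, u}. char_entry G \<sigma> w (transpose v u w)) = [:adj G \<sigma> v u * adj G \<sigma> v u:]"
      using u by (auto simp: char_entry_def adj_def insert_commute)
    \<comment> \<open>The sign of an edge occurs squared here, so the matching part does not depend
      on the signature.\<close>
    moreover have "\<sigma> {v, u} * \<sigma> {v, u} = 1" if "{v, u} \<in> edges G" using sgn that by fastforce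
    ultimately show "t (transpose v u) = (if {v, u} \<in> edges G then - F (W - {v, u}) else 0)"
      using u by (auto simp: t_def orbit_transpose sign_swap_id adj_def)
  qed
  also have "\<dots> = (\<Sum>u\<in>{u \<in> W. {v, u} \<in> edges G}. - F (W - {v, u}))"
    using finW noloop by (intro sum.mono_neutral_cong_right) auto
  also have "sum t L = (\<Sum>c\<in>L. if edges (cycle_graph c v) \<subseteq> edges G
      then Polynomial.smult (- graph_sign \<sigma> (cycle_graph c v)) (F (W - orbit c v)) else 0)"
  proof (rule sum.cong[OF refl])
    fix c assume "c \<in> L"
    note c = Lperm[OF this]
    have nofix: "c u \<noteq> u" if "u \<in> orbit c v" for u
      using cyclic_permutation_no_two_cycle[of c v u] c that by auto
    have "(\<Prod>u\<in>orbit c v. char_entry G \<sigma> u (c u)) = (\<Prod>u\<in>orbit c v. [:- adj G \<sigma> u (c u):])"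
      using nofix by (intro prod.cong refl) (metis char_entry_def)
    also have "\<dots> = [:(-1) ^ card (orbit c v) * (\<Prod>u\<in>orbit c v. adj G \<sigma> u (c u)):]"
      unfolding prod_pCons_0 prod_uminus by simp
    finally have p: "(\<Prod>u\<in>orbit c v. char_entry G \<sigma> u (c u)) =
      [:(-1) ^ card (orbit c v) * (\<Prod>u\<in>orbit c v. adj G \<sigma> u (c u)):]" .
    have s: "of_int (sign c) = [:(-1) ^ (card (orbit c v) - 1) :: real:]"
      using sign_cyclic_permutation[of c v] c by (simp add: of_int_poly)
    \<comment> \<open>A cyclic permutation of \<open>k\<close> points has sign
      \<open>(-1)^(k-1)\<close>, and the \<open>k\<close> entries of \<open>-A\<close> give
      \<open>(-1)^k\<close>: the total is -1 for every length.\<close>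
    have k: "(-1) ^ (card (orbit c v) - 1) * (-1) ^ card (orbit c v) = (-1::real)"
    proof -
      obtain k where "card (orbit c v) = Suc k" using c by (metis not_numeral_le_zero old.nat.exhaust)
      then show ?thesis by (simp flip: power_add mult_2)
    qed
    have "of_int (sign c) * (\<Prod>u\<in>orbit c v. char_entry G \<sigma> u (c u)) =
      [:((-1) ^ (card (orbit c v) - 1) * (-1) ^ card (orbit c v)) * (\<Prod>u\<in>orbit c v. adj G \<sigma> u (c u)):]"
      unfolding p s by (simp add: mult_ac)
    then have "of_int (sign c) * (\<Prod>u\<in>orbit c v. char_entry G \<sigma> u (c u)) =
      [:- (\<Prod>u\<in>orbit c v. adj G \<sigma> u (c u)):]" unfolding k by simp
    then show "t c = (if edges (cycle_graph c v) \<subseteq> edges G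
      then Polynomial.smult (- graph_sign \<sigma> (cycle_graph c v)) (F (W - orbit c v)) else 0)"
      using prod_adj_cyclic[of c v G \<sigma>] c by (simp add: t_def)
  qed
  also have "\<dots> = (\<Sum>c\<in>{c \<in> L. edges (cycle_graph c v) \<subseteq> edges G}.
     Polynomial.smult (- graph_sign \<sigma> (cycle_graph c v)) (F (W - orbit c v)))"
    by (rule sum.inter_filter[symmetric]) (use finite_cycles_at[OF finW] in \<open>simp add: L_def\<close>)
  \<comment> \<open>The permutations are grouped by the graph cycle they trace.\<close>
  also have "\<dots> = (\<Sum>C\<in>T. \<Sum>c\<in>{c \<in> {c \<in> L. edges (cycle_graph c v) \<subseteq> edges G}. cycle_graph c v = C}.
     Polynomial.smult (- graph_sign \<sigma> (cycle_graph c v)) (F (W - orbit c v)))"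
  proof (rule sum.group[symmetric])
    show "finite {c \<in> L. edges (cycle_graph c v) \<subseteq> edges G}" using finite_cycles_at[OF finW] by (simp add: L_def)
    show "finite T" using finite_cycles_in[OF G] by (simp add: T_def)
    show "(\<lambda>c. cycle_graph c v) ` {c \<in> L. edges (cycle_graph c v) \<subseteq> edges G} \<subseteq> T"
    proof (rule image_subsetI)
      fix c assume "c \<in> {c \<in> L. edges (cycle_graph c v) \<subseteq> edges G}"
      then have c: "c \<in> L" "edges (cycle_graph c v) \<subseteq> edges G" by auto
      note cl = Lperm[OF c(1)]
      have "is_cycle (cycle_graph c v)" using cl by (intro is_cycle_cycle_graph) auto
      moreover have "v \<in> orbit c v" using cl by (simp add: permutation_self_in_orbit)
      moreover have "orbit c v \<subseteq> verts G" using cl W by blast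
      ultimately show "cycle_graph c v \<in> T"
        using c cl by (auto simp: T_def cycles_in_def subgraph_def cycle_graph_def intro: orbit.step)
    qed
  qed
  also have "\<dots> = (\<Sum>C\<in>T. Polynomial.smult (- 2 * graph_sign \<sigma> C) (F (W - verts C)))"
  proof (rule sum.cong[OF refl])
    fix C assume C: "C \<in> T"
    have cyc: "is_cycle C" "v \<in> verts C" "verts C \<subseteq> W" "edges C \<subseteq> edges G"
      using C by (auto simp: T_def cycles_in_def subgraph_def)
    have card: "card (verts C) \<ge> 3" using cyc(1) by (auto simp: is_cycle_def distinct_card)
    \<comment> \<open>Membership of \<open>C\<close> in \<open>T\<close> already provides the orbit
      size, the containment in \<open>W\<close> and the edges, so the fibre consists of both
      directions around \<open>C\<close>.\<close>
    have fib: "{c \<in> {c \<in> L. edges (cycle_graph c v) \<subseteq> edges G}. cycle_graph c v = C} =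
        {c. permutation c \<and> c permutes orbit c v \<and> cycle_graph c v = C}" (is "?A = ?B")
    proof
      show "?A \<subseteq> ?B" using Lperm by auto
      show "?B \<subseteq> ?A" using cyc card by (auto simp: L_def cycles_at_def cycle_graph_def)
    qed
    have "(\<Sum>c\<in>?A. Polynomial.smult (- graph_sign \<sigma> (cycle_graph c v)) (F (W - orbit c v))) =
      (\<Sum>c\<in>?A. Polynomial.smult (- graph_sign \<sigma> C) (F (W - verts C)))"
      by (rule sum.cong) (auto simp: cycle_graph_def)
    also have "\<dots> = of_nat (card ?A) * Polynomial.smult (- graph_sign \<sigma> C) (F (W - verts C))" by simp
    also have "card ?A = 2" unfolding fib by (rule card_cyclic_permutations_of_cycle[OF cyc(1,2)])
    also have "of_nat 2 * Polynomial.smult (- graph_sign \<sigma> C) (F (W - verts C)) =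
        Polynomial.smult (- 2 * graph_sign \<sigma> C) (F (W - verts C))"
      by (rule poly_eqI) (simp add: numeral_poly)
    finally show "(\<Sum>c\<in>?A. Polynomial.smult (- graph_sign \<sigma> (cycle_graph c v)) (F (W - orbit c v))) =
      Polynomial.smult (- 2 * graph_sign \<sigma> C) (F (W - verts C))" .
  qed
  finally show ?thesis by (simp add: T_def sum_negf)
qed

section \<open>Matchings and disjoint cycles\<close>

text \<open>Families with pairwise disjoint supports inside \<open>W\<close>, where
  \<open>s x\<close> is the support of \<open>x\<close>. Matchings arise with \<open>s\<close> the
  identity, disjoint unions of cycles with \<open>s = verts\<close>.\<close>

definition packings :: "('k \<Rightarrow> 'a set) \<Rightarrow> 'k set \<Rightarrow> 'a set \<Rightarrow> 'k set set" where
  "packings s K W = {P. P \<subseteq> K \<and> (\<forall>x\<in>P. s x \<subseteq> W) \<and> pairwise (\<lambda>x y. disjnt (s x) (s y)) P}"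

lemma finite_packings: "finite K \<Longrightarrow> finite (packings s K W)"
  by (rule finite_subset[of _ "Pow K"]) (auto simp: packings_def)

lemma finite_packing: "finite K \<Longrightarrow> P \<in> packings s K W \<Longrightarrow> finite P"
  by (auto simp: packings_def intro: finite_subset)

lemma packings_empty: "(\<And>x. x \<in> K \<Longrightarrow> s x \<noteq> {}) \<Longrightarrow> packings s K {} = {{}}"
  by (auto simp: packings_def)

text \<open>At most one member of a packing covers \<^term>\<open>v\<close>.\<close>

lemma sum_packings_vertex:
  assumes K: "finite K"
  shows "sum h (packings s K W) = sum h (packings s K (W - {v})) +
    (\<Sum>x\<in>{x \<in> K. v \<in> s x \<and> s x \<subseteq> W}. \<Sum>P\<in>packings s K (W - s x). h (insert x P))"
proof -
  let ?A = "packings s K (W - {v})" and ?B = "{P \<in> packings s K W. \<exists>x\<in>P. v \<in> s x}"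
  let ?D = "SIGMA x:{x \<in> K. v \<in> s x \<and> s x \<subseteq> W}. packings s K (W - s x)"
  have "packings s K W = ?A \<union> ?B" by (auto simp: packings_def subset_iff)
  then have "sum h (packings s K W) = sum h (?A \<union> ?B)" by (rule arg_cong)
  also have "\<dots> = sum h ?A + sum h ?B"
  proof (rule sum.union_disjoint)
    show "?A \<inter> ?B = {}" by (auto simp: packings_def)
  qed (simp_all add: finite_packings[OF K])
  also have "sum h ?B = (\<Sum>p\<in>?D. h (insert (fst p) (snd p)))"
  proof (rule sum.reindex_bij_betw[symmetric])
    show "bij_betw (\<lambda>p. insert (fst p) (snd p)) ?D ?B"
    proof (rule bij_betwI')
      fix p q assume p: "p \<in> ?D" and q: "q \<in> ?D"
      \<comment> \<open>The first component is the only member covering \<open>v\<close>, so it can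
        be read off from the enlarged packing; this makes the map injective.\<close>
      have in2: "v \<in> s (fst p) \<and> (\<forall>y\<in>snd p. v \<notin> s y)" if "p \<in> ?D" for p
        using that by (auto simp: packings_def)
      show "(insert (fst p) (snd p) = insert (fst q) (snd q)) = (p = q)"
      proof
        assume eq: "insert (fst p) (snd p) = insert (fst q) (snd q)"
        have "fst p = fst q" using eq in2[OF p] in2[OF q] by blast
        moreover have "fst p \<notin> snd p" "fst q \<notin> snd q" using in2[OF p] in2[OF q] by auto
        ultimately show "p = q" using eq by (metis insert_ident prod_eq_iff)
      qed simp
    next
      fix p assume "p \<in> ?D"
      then obtain x P where p: "p = (x, P)" "x \<in> K" "v \<in> s x" "s x \<subseteq> W" "P \<in> packings s K (W - s x)" by auto
      have "disjnt (s x) (s y)" if "y \<in> P" for y using p that by (auto simp: packings_def disjnt_def)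
      then show "insert (fst p) (snd p) \<in> ?B"
        using p by (auto simp: packings_def pairwise_insert disjnt_sym)
    next
      fix Q assume "Q \<in> ?B"
      then obtain x where Q: "Q \<in> packings s K W" "x \<in> Q" "v \<in> s x" by auto
      have "disjnt (s x) (s y)" if "y \<in> Q" "y \<noteq> x" for y
        using that Q by (auto simp: packings_def pairwise_def)
      then have "Q - {x} \<in> packings s K (W - s x)"
        using Q by (fastforce simp: packings_def disjnt_def intro: pairwise_subset)
      moreover have "x \<in> K" "s x \<subseteq> W" using Q by (auto simp: packings_def)
      ultimately show "\<exists>p\<in>?D. Q = insert (fst p) (snd p)"
        using Q by (intro bexI[of _ "(x, Q - {x})"]) auto
    qed
  qed
  also have "\<dots> = (\<Sum>(x, P)\<in>?D. h (insert x P))" by (simp add: case_prod_unfold)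
  also have "\<dots> = (\<Sum>x\<in>{x \<in> K. v \<in> s x \<and> s x \<subseteq> W}. \<Sum>P\<in>packings s K (W - s x). h (insert x P))"
    by (rule sum.Sigma[symmetric]) (use K finite_packings[OF K] in auto)
  finally show ?thesis .
qed

text \<open>The matching polynomial of the subgraph induced on \<open>W\<close>, summed over single
  matchings instead of over their sizes.\<close>

definition match_sum :: "'a graph \<Rightarrow> 'a set \<Rightarrow> real poly" where
  "match_sum G W = (\<Sum>M\<in>packings (\<lambda>e. e) (edges G) W.
     Polynomial.monom ((-1) ^ card M) (card W - 2 * card M))"

text \<open>The edges of a matching are disjoint pairs inside \<open>W\<close>. This makes the
  truncated subtraction in the exponents exact.\<close>

lemma packing_edges_card:
  assumes G: "simple_graph G" and W: "finite W" and M: "M \<in> packings (\<lambda>e. e) (edges G) W"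
  shows "2 * card M \<le> card W"
proof -
  have e: "card e = 2" "e \<subseteq> W" if "e \<in> M" for e using M G that by (auto simp: packings_def simple_graph_def)
  have "card (\<Union>M) = sum card M"
    using M W e by (intro card_Union_disjoint) (auto simp: packings_def pairwise_def disjnt_def intro: finite_subset)
  also have "\<dots> = 2 * card M" using e by simp
  finally have "card (\<Union>M) = 2 * card M" .
  moreover have "card (\<Union>M) \<le> card W" using W e by (intro card_mono) auto
  ultimately show ?thesis by simp
qed

text \<open>Either \<open>v\<close> is unmatched, or it is matched to a neighbour \<open>u\<close>
  and both vertices leave the graph.\<close>

lemma match_sum_rec:
  assumes G: "simple_graph G" and W: "finite W" and v: "v \<in> W"
  shows "match_sum G W = [:0, 1:] * match_sum G (W - {v}) -
    (\<Sum>u\<in>{u \<in> W. {v, u} \<in> edges G}. match_sum G (W - {v, u}))"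
proof -
  let ?m = "\<lambda>W M. Polynomial.monom ((-1) ^ card M :: real) (card W - 2 * card M)"
  let ?P = "packings (\<lambda>e. e) (edges G)"
  note fin = finite_edges[OF G]
  have noloop: "{v} \<notin> edges G" using G by (auto simp: simple_graph_def)
  have "match_sum G W = sum (?m W) (?P (W - {v})) +
      (\<Sum>e\<in>{e \<in> edges G. v \<in> e \<and> e \<subseteq> W}. \<Sum>M\<in>?P (W - e). ?m W (insert e M))"
    unfolding match_sum_def by (rule sum_packings_vertex[OF fin])
  also have "sum (?m W) (?P (W - {v})) = [:0, 1:] * match_sum G (W - {v})"
    unfolding match_sum_def sum_distrib_left
  proof (rule sum.cong[OF refl])
    fix M assume "M \<in> ?P (W - {v})"
    from packing_edges_card[OF G _ this] have "2 * card M \<le> card W - 1" using W v by simp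
    moreover have "card W > 0" using W v card_gt_0_iff by blast
    \<comment> \<open>The subtraction is exact also without \<open>v\<close>, so the free vertex
      \<open>v\<close> raises the exponent by exactly one.\<close>
    ultimately have "card W - 2 * card M = Suc (card (W - {v}) - 2 * card M)" using v by simp
    then show "?m W M = [:0, 1:] * ?m (W - {v}) M" by (simp add: monom_Suc)
  qed
  also have "{e \<in> edges G. v \<in> e \<and> e \<subseteq> W} = (\<lambda>u. {v, u}) ` {u \<in> W. {v, u} \<in> edges G}"
  proof
    show "{e \<in> edges G. v \<in> e \<and> e \<subseteq> W} \<subseteq> (\<lambda>u. {v, u}) ` {u \<in> W. {v, u} \<in> edges G}"
    proof clarify
      fix e assume e: "e \<in> edges G" "v \<in> e" "e \<subseteq> W"
      then have "card e = 2" using G by (auto simp: simple_graph_def)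
      then obtain u where "e = {v, u}" using e by (auto simp: card_2_iff)
      then show "e \<in> (\<lambda>u. {v, u}) ` {u \<in> W. {v, u} \<in> edges G}" using e by auto
    qed
  qed (use v in auto)
  also have "(\<Sum>e\<in>(\<lambda>u. {v, u}) ` {u \<in> W. {v, u} \<in> edges G}. \<Sum>M\<in>?P (W - e). ?m W (insert e M)) =
    (\<Sum>u\<in>{u \<in> W. {v, u} \<in> edges G}. \<Sum>M\<in>?P (W - {v, u}). ?m W (insert {v, u} M))"
    by (rule sum.reindex[unfolded o_def]) (auto simp: inj_on_def doubleton_eq_iff)
  also have "\<dots> = (\<Sum>u\<in>{u \<in> W. {v, u} \<in> edges G}. - match_sum G (W - {v, u}))"
    unfolding match_sum_def sum_negf[symmetric]
  proof (intro sum.cong refl)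
    fix u M assume u: "u \<in> {u \<in> W. {v, u} \<in> edges G}" and M: "M \<in> ?P (W - {v, u})"
    have "u \<noteq> v" using u noloop by auto
    then have "card (W - {v, u}) = card W - 2" using u v W by (simp add: card_Diff_subset)
    moreover have "card (insert {v, u} M) = Suc (card M)"
      using finite_packing[OF fin M] M by (subst card_insert_disjoint) (auto simp: packings_def)
    ultimately show "?m W (insert {v, u} M) = - ?m (W - {v, u}) M"
      by (simp add: minus_monom)
  qed
  finally show ?thesis by (simp add: sum_negf)
qed

text \<open>The expansion of \<Phi> over disjoint unions of cycles: the weights multiply to
  \<open>(-2)^p(H) \<sigma>(H)\<close>, and the empty packing contributes the matching polynomial of
  the whole graph on \<open>W\<close>.\<close>

definition cycle_sum :: "'a graph \<Rightarrow> ('a set \<Rightarrow> real) \<Rightarrow> 'a set \<Rightarrow> real poly" where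
  "cycle_sum G \<sigma> W = (\<Sum>P\<in>packings verts (cycles_in G (verts G)) W.
     Polynomial.smult (\<Prod>C\<in>P. - 2 * graph_sign \<sigma> C) (match_sum G (W - \<Union>(verts ` P))))"

text \<open>If \<open>v\<close> lies on a cycle \<open>C\<close> of the packing, \<open>C\<close> is
  split off with its weight. Otherwise \<open>v\<close> is left to the matching polynomial, whose
  recurrence yields the first two terms.\<close>

lemma cycle_sum_rec:
  fixes \<sigma> :: "'a set \<Rightarrow> real"
  assumes G: "simple_graph G" and W: "W \<subseteq> verts G" and v: "v \<in> W"
  defines "F \<equiv> cycle_sum G \<sigma>"
  shows "F W = [:0, 1:] * F (W - {v}) - (\<Sum>u\<in>{u \<in> W. {v, u} \<in> edges G}. F (W - {v, u}))
     + (\<Sum>C\<in>{C \<in> cycles_in G W. v \<in> verts C}. Polynomial.smult (- 2 * graph_sign \<sigma> C) (F (W - verts C)))"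
proof -
  have finW: "finite W" using G W finite_subset by (auto simp: simple_graph_def)
  let ?K = "cycles_in G (verts G)"
  let ?P = "packings verts ?K"
  let ?w = "\<lambda>P. \<Prod>C\<in>P. - 2 * graph_sign \<sigma> C"
  let ?h = "\<lambda>P. Polynomial.smult (?w P) (match_sum G (W - \<Union>(verts ` P)))"
  let ?N = "{u \<in> W. {v, u} \<in> edges G}"
  note fin = finite_cycles_in[OF G, of "verts G"]
  have "F W = sum ?h (?P (W - {v})) +
    (\<Sum>C\<in>{C \<in> ?K. v \<in> verts C \<and> verts C \<subseteq> W}. \<Sum>P\<in>?P (W - verts C). ?h (insert C P))"
    unfolding F_def cycle_sum_def by (rule sum_packings_vertex[OF fin])
  also have "{C \<in> ?K. v \<in> verts C \<and> verts C \<subseteq> W} = {C \<in> cycles_in G W. v \<in> verts C}"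
    using W by (auto simp: cycles_in_def)
  also have "(\<Sum>C\<in>{C \<in> cycles_in G W. v \<in> verts C}. \<Sum>P\<in>?P (W - verts C). ?h (insert C P)) =
    (\<Sum>C\<in>{C \<in> cycles_in G W. v \<in> verts C}. Polynomial.smult (- 2 * graph_sign \<sigma> C) (F (W - verts C)))"
  proof (rule sum.cong[OF refl])
    fix C assume C: "C \<in> {C \<in> cycles_in G W. v \<in> verts C}"
    show "(\<Sum>P\<in>?P (W - verts C). ?h (insert C P)) =
        Polynomial.smult (- 2 * graph_sign \<sigma> C) (F (W - verts C))"
      unfolding F_def cycle_sum_def smult_sum2
    proof (rule sum.cong[OF refl])
      fix P assume P: "P \<in> ?P (W - verts C)"
      then have "C \<notin> P" using C by (auto simp: packings_def)
      then have "?w (insert C P) = - 2 * graph_sign \<sigma> C * ?w P"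
        using finite_packing[OF fin P] by simp
      moreover have "W - \<Union>(verts ` insert C P) = W - verts C - \<Union>(verts ` P)" by auto
      ultimately show "?h (insert C P) = Polynomial.smult (- 2 * graph_sign \<sigma> C)
          (Polynomial.smult (?w P) (match_sum G (W - verts C - \<Union>(verts ` P))))" by simp
    qed
  qed
  also have "sum ?h (?P (W - {v})) = (\<Sum>P\<in>?P (W - {v}).
     [:0, 1:] * Polynomial.smult (?w P) (match_sum G (W - {v} - \<Union>(verts ` P))) -
     (\<Sum>u\<in>{u \<in> ?N. u \<notin> \<Union>(verts ` P)}. Polynomial.smult (?w P) (match_sum G (W - {v, u} - \<Union>(verts ` P)))))"
  proof (rule sum.cong[OF refl])
    fix P assume P: "P \<in> ?P (W - {v})"
    let ?U = "\<Union>(verts ` P)"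
    \<comment> \<open>For a packing that avoids \<open>v\<close>, the matching recurrence sees only
      the neighbours of \<open>v\<close> outside the cycles.\<close>
    have "v \<in> W - ?U" using P v by (auto simp: packings_def)
    then have "match_sum G (W - ?U) = [:0, 1:] * match_sum G (W - ?U - {v}) -
        (\<Sum>u\<in>{u \<in> W - ?U. {v, u} \<in> edges G}. match_sum G (W - ?U - {v, u}))"
      by (intro match_sum_rec[OF G]) (use finW in auto)
    moreover have "W - ?U - {v} = W - {v} - ?U" "W - ?U - {v, u} = W - {v, u} - ?U" for u by auto
    moreover have "{u \<in> W - ?U. {v, u} \<in> edges G} = {u \<in> ?N. u \<notin> ?U}" by auto
    ultimately have "match_sum G (W - ?U) = [:0, 1:] * match_sum G (W - {v} - ?U) -
        (\<Sum>u\<in>{u \<in> ?N. u \<notin> ?U}. match_sum G (W - {v, u} - ?U))" by simp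
    then show "?h P = [:0, 1:] * Polynomial.smult (?w P) (match_sum G (W - {v} - ?U)) -
     (\<Sum>u\<in>{u \<in> ?N. u \<notin> ?U}. Polynomial.smult (?w P) (match_sum G (W - {v, u} - ?U)))"
      by (simp add: smult_diff_right smult_sum2)
  qed
  also have "\<dots> = [:0, 1:] * F (W - {v}) - (\<Sum>P\<in>?P (W - {v}). \<Sum>u\<in>{u \<in> ?N. u \<notin> \<Union>(verts ` P)}.
     Polynomial.smult (?w P) (match_sum G (W - {v, u} - \<Union>(verts ` P))))"
    by (simp only: sum_subtractf F_def cycle_sum_def sum_distrib_left)
  \<comment> \<open>After the sums are exchanged, a fixed neighbour \<open>u\<close> leaves exactly
    the packings that avoid both \<open>v\<close> and \<open>u\<close>.\<close>
  also have "(\<Sum>P\<in>?P (W - {v}). \<Sum>u\<in>{u \<in> ?N. u \<notin> \<Union>(verts ` P)}.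
     Polynomial.smult (?w P) (match_sum G (W - {v, u} - \<Union>(verts ` P)))) =
     (\<Sum>u\<in>?N. \<Sum>P\<in>{P \<in> ?P (W - {v}). u \<notin> \<Union>(verts ` P)}.
     Polynomial.smult (?w P) (match_sum G (W - {v, u} - \<Union>(verts ` P))))"
    by (rule sum.swap_restrict) (use finite_packings[OF fin] finW in auto)
  also have "\<dots> = (\<Sum>u\<in>?N. F (W - {v, u}))"
  proof (rule sum.cong[OF refl])
    fix u
    have "{P \<in> ?P (W - {v}). u \<notin> \<Union>(verts ` P)} = ?P (W - {v, u})" by (auto simp: packings_def)
    then show "(\<Sum>P\<in>{P \<in> ?P (W - {v}). u \<notin> \<Union>(verts ` P)}.
     Polynomial.smult (?w P) (match_sum G (W - {v, u} - \<Union>(verts ` P)))) = F (W - {v, u})"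
      by (simp add: F_def cycle_sum_def)
  qed
  finally show ?thesis .
qed

lemma verts_cycle_nonempty: "is_cycle C \<Longrightarrow> verts C \<noteq> {}"
  by (auto simp: is_cycle_def)

lemma perm_sum_eq_cycle_sum:
  assumes G: "simple_graph G" and sgn: "\<forall>e\<in>edges G. \<sigma> e = 1 \<or> \<sigma> e = -1"
    and W: "W \<subseteq> verts G"
  shows "perm_sum (char_entry G \<sigma>) W = cycle_sum G \<sigma> W"
proof -
  have "finite W" using G W finite_subset by (auto simp: simple_graph_def)
  then show ?thesis using W
  proof (induction W rule: finite_psubset_induct)
    case (psubset W)
    show ?case
    proof (cases "W = {}")
      case True
      have "packings verts (cycles_in G (verts G)) {} = {{}}"
        by (rule packings_empty) (auto simp: cycles_in_def verts_cycle_nonempty)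
      moreover have "packings (\<lambda>e. e) (edges G) {} = {{}}"
        using G by (intro packings_empty) (auto simp: simple_graph_def)
      ultimately show ?thesis using True
        by (simp add: perm_sum_def cycle_sum_def match_sum_def)
    next
      case False
      then obtain v where v: "v \<in> W" by auto
      \<comment> \<open>Every set removed in the two recurrences contains \<open>v\<close>, so the
        induction hypothesis covers all their terms.\<close>
      have IH: "perm_sum (char_entry G \<sigma>) (W - S) = cycle_sum G \<sigma> (W - S)" if "v \<in> S" for S
        using psubset v that by (intro psubset.IH) auto
      show ?thesis
        unfolding perm_sum_rec[OF G sgn psubset.prems v] cycle_sum_rec[OF G psubset.prems v]
        by (simp add: IH)
    qed
  qed
qed

section \<open>The characteristic polynomial and its parity\<close>

text \<open>The Leibniz formula is carried from indices to vertices by the enumeration; conjugation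
  by a bijection preserves the sign of a permutation.\<close>

lemma char_poly_adj_matrix:
  assumes G: "simple_graph G" and vs: "distinct vs" "set vs = verts G"
  shows "char_poly (adj_matrix G \<sigma> vs) = perm_sum (char_entry G \<sigma>) (verts G)"
proof -
  let ?n = "length vs"
  let ?f = "(!) vs" and ?N = "{0..<length vs}"
  let ?M = "char_poly_matrix (adj_matrix G \<sigma> vs)"
  have dim: "adj_matrix G \<sigma> vs \<in> carrier_mat ?n ?n" by (simp add: adj_matrix_def)
  have bij: "bij_betw ?f ?N (verts G)" using bij_betw_nth[OF vs(1), of ?N "verts G"] vs(2) by (simp add: atLeast0LessThan)
  have inj: "inj_on ?f ?N" using bij by (rule bij_betw_imp_inj_on)
  define g where "g = inv_into ?N ?f"
  have gf: "g (vs ! i) = i" if "i \<in> ?N" for i unfolding g_def by (rule inv_into_f_f[OF inj that])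
  have fg: "vs ! g v = v" if "v \<in> verts G" for v unfolding g_def using that bij by (simp add: bij_betw_inv_into_right)
  have bijg: "bij_betw g (verts G) ?N" unfolding g_def by (rule bij_betw_inv_into[OF bij])
  have entry: "?M $$ (i, j) = char_entry G \<sigma> (vs ! i) (vs ! j)" if "i < ?n" "j < ?n" for i j
  proof -
    have "{vs ! i} \<notin> edges G" using G by (auto simp: simple_graph_def)
    then show ?thesis using that vs(1)
      by (auto simp: char_poly_matrix_def adj_matrix_def char_entry_def adj_def nth_eq_iff_index_eq)
  qed
  have "char_poly (adj_matrix G \<sigma> vs) =
      (\<Sum>p | p permutes ?N. of_int (sign p) * (\<Prod>i\<in>?N. ?M $$ (i, p i)))"
    unfolding char_poly_def by (rule det_def') (use dim in simp)
  also have "\<dots> = perm_sum (char_entry G \<sigma>) (verts G)"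
    unfolding perm_sum_def
  proof (rule sum.reindex_bij_witness[where j = "map_permutation ?N ?f" and i = "map_permutation (verts G) g"], goal_cases)
    case (1 p)
    then show ?case using map_permutation_compose_inv[OF bij, of p g] gf by auto
  next
    case (2 p)
    then show ?case using map_permutation_permutes[OF bij] by simp
  next
    case (3 q)
    then show ?case using map_permutation_compose_inv[OF bijg, of q ?f] fg by auto
  next
    case (4 q)
    then show ?case using map_permutation_permutes[OF bijg] by simp
  next
    case (5 p)
    then have p: "p permutes ?N" by simp
    have "(\<Prod>u\<in>verts G. char_entry G \<sigma> u (map_permutation ?N ?f p u)) =
        (\<Prod>i\<in>?N. char_entry G \<sigma> (vs ! i) (map_permutation ?N ?f p (vs ! i)))"
      by (rule prod.reindex_bij_betw[OF bij, symmetric])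
    also have "\<dots> = (\<Prod>i\<in>?N. ?M $$ (i, p i))"
    proof (rule prod.cong[OF refl])
      fix i assume i: "i \<in> ?N"
      then have "p i \<in> ?N" using permutes_in_image[OF p] by blast
      then show "char_entry G \<sigma> (vs ! i) (map_permutation ?N ?f p (vs ! i)) = ?M $$ (i, p i)"
        using map_permutation_apply[OF inj i, of p] entry i by simp
    qed
    finally show ?case using sign_map_permutation[OF inj p] by simp
  qed
  finally show ?thesis .
qed

text \<open>Every exponent \<open>card W - 2 * card M\<close> has the parity of
  \<open>card W\<close>.\<close>

lemma poly_match_sum_uminus:
  assumes G: "simple_graph G" and W: "finite W"
  shows "poly (match_sum G W) (- x) = (-1) ^ card W * poly (match_sum G W) x"
  unfolding match_sum_def poly_sum sum_distrib_left
proof (rule sum.cong[OF refl])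
  fix M assume "M \<in> packings (\<lambda>e. e) (edges G) W"
  from packing_edges_card[OF G W this] obtain k where "card W = 2 * card M + k" using le_Suc_ex by blast
  then show "poly (Polynomial.monom ((-1) ^ card M) (card W - 2 * card M)) (- x) =
     (-1) ^ card W * poly (Polynomial.monom ((-1) ^ card M) (card W - 2 * card M)) x"
    by (simp add: poly_monom power_minus[of x] power_add)
qed

text \<open>With \<open>n\<close> vertices in all, a term \<open>h\<close> whose cycles cover
  \<open>U\<close> satisfies \<open>h(-x) = (-1)^(n-|U|) h(x)\<close>. Hence
  \<open>h(x) - (-1)^n h(-x)\<close> is zero for \<open>|U|\<close> even and \<open>2 h(x)\<close>
  for \<open>|U|\<close> odd.\<close>

lemma cycle_sum_uminus:
  fixes \<sigma> :: "'a set \<Rightarrow> real"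
  assumes G: "simple_graph G"
  shows "(\<forall>x. poly (cycle_sum G \<sigma> (verts G)) (- x) = (-1) ^ card (verts G) * poly (cycle_sum G \<sigma> (verts G)) x) \<longleftrightarrow>
   (\<Sum>P\<in>{P \<in> packings verts (cycles_in G (verts G)) (verts G). odd (card (\<Union>(verts ` P)))}.
     Polynomial.smult (\<Prod>C\<in>P. - 2 * graph_sign \<sigma> C) (match_sum G (verts G - \<Union>(verts ` P)))) = 0"
    (is "?L \<longleftrightarrow> ?S = 0")
proof -
  let ?V = "verts G" and ?K = "packings verts (cycles_in G (verts G)) (verts G)"
  let ?U = "\<lambda>P. \<Union>(verts ` P)"
  let ?h = "\<lambda>P. Polynomial.smult (\<Prod>C\<in>P. - 2 * graph_sign \<sigma> C) (match_sum G (?V - ?U P))"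
  have finV: "finite ?V" using G by (simp add: simple_graph_def)
  have sg: "a - b = (if odd k then 2 * a else 0)" if "b = (-1) ^ k * a" for a b :: real and k using that by auto
  have h: "poly (?h P) x - (-1) ^ card ?V * poly (?h P) (- x) = (if odd (card (?U P)) then 2 * poly (?h P) x else 0)"
    if "P \<in> ?K" for P x
  proof -
    have sub: "?U P \<subseteq> ?V" using that by (auto simp: packings_def)
    then have "card ?V = card (?V - ?U P) + card (?U P)" using finV
      by (metis card_Diff_subset card_mono finite_subset le_add_diff_inverse2)
    then have "(-1) ^ card ?V * (-1) ^ card (?V - ?U P) = ((-1) ^ card (?U P) :: real)"
      by (simp add: power_add flip: power_mult_distrib)
    note sgn = this
    have "poly (?h P) (- x) = (-1) ^ card (?V - ?U P) * poly (?h P) x"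
      using poly_match_sum_uminus[OF G, of "?V - ?U P" x] finV by simp
    then have "(-1) ^ card ?V * poly (?h P) (- x) = (-1) ^ card (?U P) * poly (?h P) x"
      by (simp only: sgn mult.assoc[symmetric])
    then show ?thesis by (rule sg)
  qed
  have diff: "poly (cycle_sum G \<sigma> ?V) x - (-1) ^ card ?V * poly (cycle_sum G \<sigma> ?V) (- x) = 2 * poly ?S x" for x
  proof -
    have "poly (cycle_sum G \<sigma> ?V) x - (-1) ^ card ?V * poly (cycle_sum G \<sigma> ?V) (- x) =
        (\<Sum>P\<in>?K. poly (?h P) x - (-1) ^ card ?V * poly (?h P) (- x))"
      unfolding cycle_sum_def poly_sum sum_subtractf sum_distrib_left ..
    also have "\<dots> = (\<Sum>P\<in>?K. if odd (card (?U P)) then 2 * poly (?h P) x else 0)"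
      by (rule sum.cong[OF refl h])
    also have "\<dots> = (\<Sum>P\<in>{P \<in> ?K. odd (card (?U P))}. 2 * poly (?h P) x)"
      by (rule sum.inter_filter[symmetric]) (simp add: finite_packings finite_cycles_in[OF G])
    also have "\<dots> = 2 * poly ?S x" by (simp only: poly_sum sum_distrib_left)
    finally show ?thesis .
  qed
  have pm: "((-1) ^ k * a = b) = (a = (-1) ^ k * b)" for a b :: real and k by (cases "even k") auto
  have "?L \<longleftrightarrow> (\<forall>x. poly ?S x = 0)"
  proof (intro iff_allI)
    fix x show "(poly (cycle_sum G \<sigma> ?V) (- x) = (-1) ^ card ?V * poly (cycle_sum G \<sigma> ?V) x) = (poly ?S x = 0)"
      using diff[of x] pm[of "card ?V" "poly (cycle_sum G \<sigma> ?V) (- x)" "poly (cycle_sum G \<sigma> ?V) x"] by auto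
  qed
  then show ?thesis using poly_all_0_iff_0 by blast
qed

section \<open>The matching polynomial of \<open>G - C\<close>\<close>

lemma matching_poly_eq_sum:
  assumes "finite (edges K)"
  shows "matching_poly K = (\<Sum>M\<in>matchings K. Polynomial.monom ((-1) ^ card M) (card (verts K) - 2 * card M))"
proof -
  have fin: "finite (matchings K)" by (rule finite_subset[of _ "Pow (edges K)"]) (auto simp: matchings_def assms)
  \<comment> \<open>No matching has more than \<open>matching_number K\<close> edges, so grouping by
    size loses none.\<close>
  have "(\<Sum>M\<in>matchings K. Polynomial.monom ((-1) ^ card M :: real) (card (verts K) - 2 * card M)) =
    (\<Sum>i\<in>{0..matching_number K}. \<Sum>M\<in>{M \<in> matchings K. card M = i}.
       Polynomial.monom ((-1) ^ card M) (card (verts K) - 2 * card M))"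
    by (rule sum.group[symmetric]) (use fin in \<open>auto simp: matching_number_def\<close>)
  also have "\<dots> = matching_poly K"
    unfolding matching_poly_def num_matchings_def
    by (intro sum.cong refl) (simp add: of_nat_poly monom_altdef mult.commute)
  finally show ?thesis ..
qed

lemma matching_poly_delete_verts:
  assumes "simple_graph G"
  shows "matching_poly (delete_verts_of G H) = match_sum G (verts G - verts H)"
proof -
  have "matchings (delete_verts_of G H) = packings (\<lambda>e. e) (edges G) (verts G - verts H)"
    by (auto simp: matchings_def packings_def delete_verts_of_def induced_subgraph_def)
  moreover have "finite (edges (delete_verts_of G H))"
    using finite_edges[OF assms] by (simp add: delete_verts_of_def induced_subgraph_def)
  ultimately show ?thesis
    unfolding match_sum_def by (simp add: matching_poly_eq_sum) (simp add: delete_verts_of_def induced_subgraph_def)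
qed

section \<open>Two-regular subgraphs\<close>

definition union_graph :: "'a graph set \<Rightarrow> 'a graph" where
  "union_graph P = (\<Union>C\<in>P. verts C, \<Union>C\<in>P. edges C)"

text \<open>Following the successor map from \<open>u\<close> reaches every vertex, and each step is
  an edge.\<close>

lemma cycle_connected:
  assumes C: "is_cycle C" and u: "u \<in> verts C" and w: "w \<in> verts C"
  shows "(u, w) \<in> {(u, v). {u, v} \<in> edges C}\<^sup>*"
proof -
  obtain cs where cs: "distinct cs" "C = (set cs, (\<lambda>u. {u, cycle_of_list cs u}) ` set cs)"
    using C by (auto simp: is_cycle_iff_cycle_of_list)
  have "w \<in> orbit (cycle_of_list cs) u" using orbit_cycle_of_list[OF cs(1), of u] cs u w by simp
  then show ?thesis
  proof induction
    case base
    show ?case using u cs by auto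
  next
    case (step y)
    have "y \<in> set cs" using step(1) orbit_cycle_of_list[OF cs(1), of u] cs u by simp
    then have "(y, cycle_of_list cs y) \<in> {(u, v). {u, v} \<in> edges C}" using cs by auto
    then show ?case using step(2) by (rule rtrancl_into_rtrancl[rotated])
  qed
qed

context
  fixes G :: "'a graph" and P :: "'a graph set" and W :: "'a set"
  assumes G: "simple_graph G" and P: "P \<in> packings verts (cycles_in G W) W"
begin

lemma packing_cycle:
  assumes "C \<in> P"
  shows "is_cycle C" "subgraph C G" "verts C \<noteq> {}" "\<And>e. e \<in> edges C \<Longrightarrow> e \<subseteq> verts C \<and> e \<noteq> {}"
proof -
  show 1: "is_cycle C" "subgraph C G" using assms P by (auto simp: packings_def cycles_in_def)
  then show "verts C \<noteq> {}" by (simp add: verts_cycle_nonempty)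
  show "e \<subseteq> verts C \<and> e \<noteq> {}" if "e \<in> edges C" for e
    using 1 that G by (fastforce simp: subgraph_def simple_graph_def)
qed

lemma packing_cycle_unique: "\<lbrakk>C \<in> P; D \<in> P; v \<in> verts C; v \<in> verts D\<rbrakk> \<Longrightarrow> C = D"
  using P unfolding packings_def pairwise_def disjnt_iff by blast

text \<open>A path in the union cannot leave \<open>C\<close>: each of its edges lies in a cycle of
  \<open>P\<close>, and a cycle of \<open>P\<close> that meets \<open>C\<close> is \<open>C\<close>
  itself.\<close>

lemma union_graph_component:
  assumes C: "C \<in> P" and u: "u \<in> verts C"
  shows "reachability (union_graph P) `` {u} = verts C"
proof
  show "reachability (union_graph P) `` {u} \<subseteq> verts C"
  proof
    fix w assume "w \<in> reachability (union_graph P) `` {u}"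
    then have "(u, w) \<in> {(u, v). {u, v} \<in> edges (union_graph P)}\<^sup>*" by (auto simp: reachability_def)
    then show "w \<in> verts C"
    proof induction
      case (step y z)
      then obtain D where D: "D \<in> P" "{y, z} \<in> edges D" by (auto simp: union_graph_def)
      then have "{y, z} \<subseteq> verts D" using packing_cycle(4) by blast
      then show ?case using packing_cycle_unique[OF C D(1), of y] step by auto
    qed (use u in simp)
  qed
  have "{(u, v). {u, v} \<in> edges C}\<^sup>* \<subseteq> {(u, v). {u, v} \<in> edges (union_graph P)}\<^sup>*"
    using C by (intro rtrancl_mono) (auto simp: union_graph_def)
  then show "verts C \<subseteq> reachability (union_graph P) `` {u}"
    using cycle_connected[OF packing_cycle(1)[OF C] u] C u by (auto simp: reachability_def union_graph_def)
qed

lemma union_graph_components: "verts (union_graph P) // reachability (union_graph P) = verts ` P"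
proof
  show "verts (union_graph P) // reachability (union_graph P) \<subseteq> verts ` P"
    using union_graph_component by (auto simp: quotient_def union_graph_def)
  show "verts ` P \<subseteq> verts (union_graph P) // reachability (union_graph P)"
  proof
    fix S assume "S \<in> verts ` P"
    then obtain C u where "C \<in> P" "S = verts C" "u \<in> verts C" using packing_cycle(3) by blast
    then show "S \<in> verts (union_graph P) // reachability (union_graph P)"
      using union_graph_component[of C u] by (auto simp: quotient_def union_graph_def)
  qed
qed

text \<open>The vertex sets of distinct cycles are nonempty and disjoint, hence distinct, so
  \<open>p(H)\<close> counts the cycles.\<close>

lemma num_components_union_graph: "num_components (union_graph P) = card P"
proof -
  have "inj_on verts P" using packing_cycle(3) packing_cycle_unique by (metis all_not_in_conv inj_onI)
  then show ?thesis by (simp add: num_components_def union_graph_components card_image)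
qed

text \<open>The cycles of a two-regular graph are its connected components.\<close>

lemma packing_recovered:
  "P = (\<lambda>S. (S, {e \<in> edges (union_graph P). e \<subseteq> S})) `
    (verts (union_graph P) // reachability (union_graph P))"
proof -
  have "{e \<in> edges (union_graph P). e \<subseteq> verts C} = edges C" if C: "C \<in> P" for C
  proof
    show "{e \<in> edges (union_graph P). e \<subseteq> verts C} \<subseteq> edges C"
    proof clarify
      fix e assume e: "e \<in> edges (union_graph P)" "e \<subseteq> verts C"
      then obtain D where D: "D \<in> P" "e \<in> edges D" by (auto simp: union_graph_def)
      \<comment> \<open>A vertex of the edge lies on both \<open>C\<close> and \<open>D\<close>, so
        the two cycles coincide.\<close>
      then obtain x where "x \<in> e" "x \<in> verts D" using packing_cycle(4)[OF D] by blast
      then show "e \<in> edges C" using packing_cycle_unique[OF C D(1), of x] D e by auto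
    qed
    show "edges C \<subseteq> {e \<in> edges (union_graph P). e \<subseteq> verts C}"
      using packing_cycle(4)[OF C] C by (auto simp: union_graph_def)
  qed
  then show ?thesis unfolding union_graph_components image_image by simp
qed

text \<open>Vertex-disjoint cycles share no edge, as edges are nonempty sets of vertices, so the
  product over all edges splits by cycles.\<close>

lemma graph_sign_union_graph: "graph_sign \<sigma> (union_graph P) = (\<Prod>C\<in>P. graph_sign \<sigma> C)"
  unfolding graph_sign_def union_graph_def snd_conv
proof (rule prod.UNION_disjoint)
  show "finite P" using finite_packing[OF finite_cycles_in[OF G] P] .
  show "\<forall>C\<in>P. finite (edges C)"
    using packing_cycle(2) finite_edges[OF G] by (auto simp: subgraph_def intro: finite_subset)
  show "\<forall>C\<in>P. \<forall>D\<in>P. C \<noteq> D \<longrightarrow> edges C \<inter> edges D = {}"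
  proof (intro ballI impI)
    fix C D assume CD: "C \<in> P" "D \<in> P" "C \<noteq> D"
    show "edges C \<inter> edges D = {}"
    proof (rule ccontr)
      assume "edges C \<inter> edges D \<noteq> {}"
      then obtain e x where "e \<in> edges C" "e \<in> edges D" "x \<in> e" using packing_cycle(4)[OF CD(1)] by blast
      then show False
        using packing_cycle(4)[OF CD(1)] packing_cycle(4)[OF CD(2)] packing_cycle_unique[OF CD(1,2), of x] CD(3) by blast
    qed
  qed
qed

end

text \<open>Containment in \<open>verts G\<close> is part of \<open>subgraph\<close>, so what
  remains are the conditions in the definition of a two-regular subgraph.\<close>

lemma packings_cycles_in_iff:
  "P \<in> packings verts (cycles_in G (verts G)) (verts G) \<longleftrightarrow>
    (\<forall>C\<in>P. is_cycle C \<and> subgraph C G) \<and> pairwise (\<lambda>C D. disjnt (verts C) (verts D)) P"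
  unfolding packings_def cycles_in_def subgraph_def by blast

lemma odd_two_regular_eq:
  "odd_two_regular G = union_graph ` {P \<in> packings verts (cycles_in G (verts G)) (verts G).
    odd (card (\<Union>(verts ` P)))}" (is "_ = union_graph ` ?R")
proof -
  have two: "two_regular_subgraph H G \<longleftrightarrow>
    (\<exists>P. P \<noteq> {} \<and> P \<in> packings verts (cycles_in G (verts G)) (verts G) \<and> H = union_graph P)" for H
    by (simp only: two_regular_subgraph_def packings_cycles_in_iff union_graph_def conj_assoc)
  have vu: "verts (union_graph P) = \<Union>(verts ` P)" for P :: "'a graph set" by (simp add: union_graph_def)
  show ?thesis
  proof (intro equalityI subsetI)
    fix H assume "H \<in> odd_two_regular G"
    then obtain P where "P \<in> packings verts (cycles_in G (verts G)) (verts G)" "H = union_graph P"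
      "odd (card (verts H))" unfolding odd_two_regular_def two by auto
    then show "H \<in> union_graph ` ?R" using vu by auto
  next
    fix H assume "H \<in> union_graph ` ?R"
    then obtain P where P: "P \<in> packings verts (cycles_in G (verts G)) (verts G)" "H = union_graph P"
      "odd (card (\<Union>(verts ` P)))" by auto
    \<comment> \<open>The empty packing covers 0 vertices, an even number.\<close>
    then have "P \<noteq> {}" by auto
    with P show "H \<in> odd_two_regular G" unfolding odd_two_regular_def two using vu by auto
  qed
qed

text \<open>Taking the connected components of the union is a left inverse.\<close>

lemma inj_on_union_graph:
  assumes G: "simple_graph G"
  shows "inj_on union_graph (packings verts (cycles_in G W) W)"
  by (rule inj_on_inverseI[where g = "\<lambda>H. (\<lambda>S. (S, {e \<in> edges H. e \<subseteq> S})) ` (verts H // reachability H)"])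
    (rule packing_recovered[OF G, symmetric])

section \<open>Spectra of real symmetric matrices\<close>

text \<open>For an eigenvector \<open>v\<close>, the Hermitian form \<open>S\<close> of
  \<open>A\<close> at \<open>v\<close> is its own conjugate by symmetry, and it equals
  \<open>a\<close> times the nonzero squared norm \<open>N\<close> of \<open>v\<close>.\<close>

lemma symmetric_real_mat_eigenvalue_real:
  fixes A :: "real mat"
  assumes A: "A \<in> carrier_mat n n" and sym: "\<And>i j. i < n \<Longrightarrow> j < n \<Longrightarrow> A $$ (i, j) = A $$ (j, i)"
    and ev: "eigenvalue (map_mat complex_of_real A) a"
  shows "a \<in> \<real>"
proof -
  obtain v where v: "v \<in> carrier_vec n" "v \<noteq> 0\<^sub>v n" "map_mat complex_of_real A *\<^sub>v v = a \<cdot>\<^sub>v v"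
    using ev A by (auto simp: eigenvalue_def eigenvector_def)
  have row: "(\<Sum>j<n. of_real (A $$ (i, j)) * v $ j) = a * v $ i" if i: "i < n" for i
  proof -
    have "(map_mat complex_of_real A *\<^sub>v v) $ i = (\<Sum>j<n. of_real (A $$ (i, j)) * v $ j)"
      using i A v(1) by (simp add: scalar_prod_def atLeast0LessThan)
    then show ?thesis using v i by simp
  qed
  define S where "S = (\<Sum>i<n. \<Sum>j<n. cnj (v $ i) * of_real (A $$ (i, j)) * v $ j)"
  define N where "N = (\<Sum>i<n. (cmod (v $ i))\<^sup>2)"
  have "cnj S = (\<Sum>i<n. \<Sum>j<n. cnj (v $ j) * of_real (A $$ (j, i)) * v $ i)"
    unfolding S_def cnj_sum by (intro sum.cong refl) (use sym in \<open>simp add: mult_ac\<close>)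
  also have "\<dots> = S" unfolding S_def by (rule sum.swap)
  finally have "S \<in> \<real>" by (simp add: Reals_cnj_iff)
  moreover have "S = a * of_real N"
  proof -
    have "S = (\<Sum>i<n. cnj (v $ i) * (a * v $ i))"
      unfolding S_def by (intro sum.cong refl) (simp add: row[symmetric] sum_distrib_left mult.assoc)
    also have "\<dots> = a * of_real N"
      unfolding N_def of_real_sum sum_distrib_left
      by (intro sum.cong refl) (simp add: complex_norm_square mult_ac del: of_real_power)
    finally show ?thesis .
  qed
  moreover have "N \<noteq> 0"
  proof
    assume "N = 0"
    then have "v $ i = 0" if "i < n" for i using that by (simp add: N_def sum_nonneg_eq_0_iff)
    then have "v = 0\<^sub>v n" using v(1) by (intro eq_vecI) auto
    then show False using v by simp
  qed
  ultimately show ?thesis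
    by (metis Reals_divide Reals_of_real nonzero_mult_div_cancel_right of_real_eq_0_iff)
qed

text \<open>Over the complex numbers the characteristic polynomial splits, and its roots are real.
  The factorization descends because the embedding of the reals is injective on polynomials.\<close>

lemma symmetric_real_mat_char_poly_splits:
  fixes A :: "real mat"
  assumes A: "A \<in> carrier_mat n n" and sym: "\<And>i j. i < n \<Longrightarrow> j < n \<Longrightarrow> A $$ (i, j) = A $$ (j, i)"
  obtains bs where "char_poly A = (\<Prod>b\<leftarrow>bs. [:- b, 1:])" "length bs = n"
proof -
  let ?A = "map_mat complex_of_real A"
  have A': "?A \<in> carrier_mat n n" using A by simp
  obtain as where as: "char_poly ?A = (\<Prod>a\<leftarrow>as. [:- a, 1:])" "length as = n"
    using char_poly_factorized[OF A'] by auto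
  have "a \<in> \<real>" if "a \<in> set as" for a
  proof -
    have "poly (char_poly ?A) a = 0" unfolding as using that by (auto simp: poly_prod_list prod_list_zero_iff)
    then have "eigenvalue ?A a" using eigenvalue_root_char_poly[OF A'] by simp
    then show ?thesis using symmetric_real_mat_eigenvalue_real[OF A sym] by blast
  qed
  then have "map (of_real \<circ> Re) as = map id as" by (intro map_cong refl) auto
  then have Re: "as = map of_real (map Re as)" by simp
  interpret mp: map_poly_inj_idom_hom complex_of_real ..
  have "map_poly complex_of_real (char_poly A) = char_poly ?A"
    by (rule of_real_hom.char_poly_hom[OF A, symmetric])
  also have "\<dots> = (\<Prod>b\<leftarrow>map Re as. [:- of_real b, 1:])" unfolding as(1) by (subst Re) (simp only: map_map o_def)
  also have "\<dots> = map_poly of_real (\<Prod>b\<leftarrow>map Re as. [:- b, 1:])"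
    by (induction as) (simp_all add: mp.hom_mult del: mult_pCons_left)
  finally have "char_poly A = (\<Prod>b\<leftarrow>map Re as. [:- b, 1:])"
    by (simp only: mp.eq_iff)
  then show ?thesis by (rule that) (simp add: as(2))
qed

lemma order_prod_linear: "Polynomial.order x (\<Prod>b\<leftarrow>bs. [:- b, 1:]) = count (mset bs) (x :: 'b::idom)"
proof (induction bs)
  case (Cons b bs)
  have "[:- b, 1:] * (\<Prod>b\<leftarrow>bs. [:- b, 1:]) \<noteq> 0" by (auto simp: prod_list_zero_iff simp del: mult_pCons_left)
  then have "Polynomial.order x (\<Prod>b\<leftarrow>b # bs. [:- b, 1:]) = Polynomial.order x [:- b, 1:] + count (mset bs) x"
    using Cons Polynomial.order_mult[of "[:- b, 1:]" "\<Prod>b\<leftarrow>bs. [:- b, 1:]" x] by simp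
  also have "Polynomial.order x [:- b, 1:] = (if x = b then 1 else 0)"
    using order_linear_power[of x "- b" 1] by simp
  finally show ?case by simp
qed (simp add: order_0I)

text \<open>If \<open>p\<close> is the product of the factors \<open>x - b\<close>, then
  \<open>p(-x)\<close> is \<open>(-1)^n\<close> times the product of the factors
  \<open>x + b\<close>. The condition thus says that the multiset of roots is invariant under
  negation, because a product of linear factors determines that multiset.\<close>

lemma symmetric_spectrum_iff:
  assumes A: "A \<in> carrier_mat n n" and sym: "\<And>i j. i < n \<Longrightarrow> j < n \<Longrightarrow> A $$ (i, j) = A $$ (j, i)"
  shows "symmetric_spectrum A \<longleftrightarrow> (\<forall>x. poly (char_poly A) (- x) = (-1) ^ n * poly (char_poly A) x)"
proof -
  let ?p = "char_poly A"
  obtain bs where bs: "?p = (\<Prod>b\<leftarrow>bs. [:- b, 1:])" "length bs = n"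
    using symmetric_real_mat_char_poly_splits[OF A sym] by metis
  have ord: "Polynomial.order l ?p = count (mset bs) l" for l unfolding bs(1) by (rule order_prod_linear)
  have "?p \<noteq> 0" unfolding bs(1) by (auto simp: prod_list_zero_iff)
  then have ev: "eigenvalue A l \<longleftrightarrow> count (mset bs) l \<noteq> 0" for l
    unfolding eigenvalue_root_char_poly[OF A] ord[symmetric] by (simp add: order_root)
  have cnt: "count (mset (map uminus bs)) l = count (mset bs) (- l)" for l
    by (induction bs) (auto simp: minus_equation_iff)
  have refl: "poly ?p (- x) = (-1) ^ n * poly (\<Prod>b\<leftarrow>map uminus bs. [:- b, 1:]) x" for x
    unfolding bs(1) bs(2)[symmetric] by (induction bs) (simp_all add: algebra_simps)
  \<comment> \<open>The definition constrains eigenvalues only; if just \<open>- l\<close> is an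
    eigenvalue, it applies to \<open>- l\<close> in place of \<open>l\<close>.\<close>
  have "symmetric_spectrum A \<longleftrightarrow> (\<forall>l. count (mset bs) (- l) = count (mset bs) l)"
    unfolding symmetric_spectrum_def ev ord by (metis minus_minus)
  also have "\<dots> \<longleftrightarrow> mset (map uminus bs) = mset bs" using cnt by (simp add: multiset_eq_iff)
  also have "\<dots> \<longleftrightarrow> (\<Prod>b\<leftarrow>map uminus bs. [:- b, 1:]) = ?p"
  proof
    assume "mset (map uminus bs) = mset bs"
    then have "mset (map (\<lambda>b. [:- b, 1:]) (map uminus bs)) = mset (map (\<lambda>b. [:- b, 1:]) bs)"
      by (metis mset_map)
    then show "(\<Prod>b\<leftarrow>map uminus bs. [:- b, 1:]) = ?p"
      unfolding bs(1) by (metis prod_mset_prod_list)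
  next
    assume "(\<Prod>b\<leftarrow>map uminus bs. [:- b, 1:]) = ?p"
    then show "mset (map uminus bs) = mset bs"
      unfolding multiset_eq_iff order_prod_linear[symmetric] bs(1) by simp
  qed
  also have "\<dots> \<longleftrightarrow> (\<forall>x. poly ?p (- x) = (-1) ^ n * poly ?p x)"
    unfolding refl poly_eq_poly_eq_iff[symmetric] fun_eq_iff by simp
  finally show ?thesis .
qed

section \<open>The symmetry criterion\<close>

text \<open>Passing from a packing \<open>P\<close> to \<open>H = union_graph P\<close> turns the
  product of weights into \<open>\<sigma>(H) (-2)^p(H)\<close>, and the value of
  \<open>\<sigma>(H)\<close> splits the sum in two.\<close>

lemma cycle_sum_odd_eq:
  fixes \<sigma> :: "'a set \<Rightarrow> real"
  assumes G: "simple_graph G" and sgn: "\<forall>e\<in>edges G. \<sigma> e = 1 \<or> \<sigma> e = -1"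
  shows "(\<Sum>P\<in>{P \<in> packings verts (cycles_in G (verts G)) (verts G). odd (card (\<Union>(verts ` P)))}.
     Polynomial.smult (\<Prod>C\<in>P. - 2 * graph_sign \<sigma> C) (match_sum G (verts G - \<Union>(verts ` P)))) =
   (\<Sum>C\<in>pos_odd_two_regular G \<sigma>.
        Polynomial.smult ((-2) ^ num_components C) (matching_poly (delete_verts_of G C))) -
   (\<Sum>C\<in>neg_odd_two_regular G \<sigma>.
        Polynomial.smult ((-2) ^ num_components C) (matching_poly (delete_verts_of G C)))"
    (is "?lhs = sum ?t _ - sum ?t _")
proof -
  let ?R = "{P \<in> packings verts (cycles_in G (verts G)) (verts G). odd (card (\<Union>(verts ` P)))}"
  have fin: "finite (odd_two_regular G)"
    unfolding odd_two_regular_eq by (simp add: finite_packings finite_cycles_in[OF G])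
  have sign: "graph_sign \<sigma> H = 1 \<or> graph_sign \<sigma> H = -1" if H: "H \<in> odd_two_regular G" for H
  proof -
    have sub: "edges H \<subseteq> edges G"
    proof -
      obtain P where P: "P \<subseteq> cycles_in G (verts G)" "H = union_graph P"
        using H by (auto simp: odd_two_regular_eq packings_def)
      have "\<forall>C\<in>P. edges C \<subseteq> edges G" using P(1) unfolding cycles_in_def subgraph_def by blast
      then show ?thesis using P(2) by (simp add: union_graph_def UN_subset_iff)
    qed
    then have "finite (edges H)" using finite_edges[OF G] finite_subset by blast
    then have "\<bar>graph_sign \<sigma> H\<bar> = (\<Prod>e\<in>edges H. 1)"
      unfolding graph_sign_def abs_prod by (intro prod.cong refl) (use sub sgn in fastforce)
    then show ?thesis by (simp add: abs_if split: if_splits)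
  qed
  have "?lhs = (\<Sum>P\<in>?R. Polynomial.smult (graph_sign \<sigma> (union_graph P)) (?t (union_graph P)))"
  proof (rule sum.cong[OF refl])
    fix P assume "P \<in> ?R"
    then have P: "P \<in> packings verts (cycles_in G (verts G)) (verts G)" by simp
    have "(\<Prod>C\<in>P. - 2 * graph_sign \<sigma> C) = graph_sign \<sigma> (union_graph P) * (-2) ^ num_components (union_graph P)"
      unfolding graph_sign_union_graph[OF G P] num_components_union_graph[OF G P] prod.distrib by simp
    moreover have "verts (union_graph P) = \<Union>(verts ` P)" by (simp add: union_graph_def)
    ultimately show "Polynomial.smult (\<Prod>C\<in>P. - 2 * graph_sign \<sigma> C) (match_sum G (verts G - \<Union>(verts ` P))) =
       Polynomial.smult (graph_sign \<sigma> (union_graph P)) (?t (union_graph P))"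
      by (simp only: matching_poly_delete_verts[OF G] smult_smult)
  qed
  also have "\<dots> = (\<Sum>H\<in>odd_two_regular G. Polynomial.smult (graph_sign \<sigma> H) (?t H))"
    unfolding odd_two_regular_eq
    by (rule sum.reindex[symmetric, unfolded o_def]) (auto intro: inj_on_subset[OF inj_on_union_graph[OF G]])
  also have "odd_two_regular G = pos_odd_two_regular G \<sigma> \<union> neg_odd_two_regular G \<sigma>"
    using sign by (auto simp: pos_odd_two_regular_def neg_odd_two_regular_def)
  also have "(\<Sum>H\<in>pos_odd_two_regular G \<sigma> \<union> neg_odd_two_regular G \<sigma>. Polynomial.smult (graph_sign \<sigma> H) (?t H)) =
    (\<Sum>H\<in>pos_odd_two_regular G \<sigma>. Polynomial.smult (graph_sign \<sigma> H) (?t H)) +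
    (\<Sum>H\<in>neg_odd_two_regular G \<sigma>. Polynomial.smult (graph_sign \<sigma> H) (?t H))"
    by (rule sum.union_disjoint) (use fin in \<open>auto simp: pos_odd_two_regular_def neg_odd_two_regular_def\<close>)
  also have "\<dots> = sum ?t (pos_odd_two_regular G \<sigma>) + (\<Sum>H\<in>neg_odd_two_regular G \<sigma>. - ?t H)"
    by (intro arg_cong2[where f = "(+)"] sum.cong refl)
      (simp_all add: pos_odd_two_regular_def neg_odd_two_regular_def)
  finally show ?thesis by (simp add: sum_negf)
qed

theorem theorem2p4:
  fixes G :: "'a graph" and \<sigma> :: "'a set \<Rightarrow> real" and vs :: "'a list"
  assumes "signed_graph G \<sigma>"
    and "distinct vs" and "set vs = verts G"
  shows "symmetric_spectrum (adj_matrix G \<sigma> vs) \<longleftrightarrow>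
    (\<Sum>C\<in>pos_odd_two_regular G \<sigma>.
        Polynomial.smult ((-2) ^ num_components C) (matching_poly (delete_verts_of G C))) =
    (\<Sum>C\<in>neg_odd_two_regular G \<sigma>.
        Polynomial.smult ((-2) ^ num_components C) (matching_poly (delete_verts_of G C)))"
proof -
  have G: "simple_graph G" and sgn: "\<forall>e\<in>edges G. \<sigma> e = 1 \<or> \<sigma> e = -1"
    using assms(1) by (auto simp: signed_graph_def)
  have n: "length vs = card (verts G)" using assms(2,3) distinct_card by metis
  have cp: "char_poly (adj_matrix G \<sigma> vs) = cycle_sum G \<sigma> (verts G)"
    unfolding char_poly_adj_matrix[OF G assms(2,3)] by (rule perm_sum_eq_cycle_sum[OF G sgn subset_refl])
  have "symmetric_spectrum (adj_matrix G \<sigma> vs) \<longleftrightarrow>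
    (\<forall>x. poly (cycle_sum G \<sigma> (verts G)) (- x) = (-1) ^ card (verts G) * poly (cycle_sum G \<sigma> (verts G)) x)"
    unfolding cp[symmetric] n[symmetric]
    by (rule symmetric_spectrum_iff) (auto simp: adj_matrix_def insert_commute)
  \<comment> \<open>The odd terms sum to zero exactly when their positive and negative parts
    agree.\<close>
  then show ?thesis
    unfolding cycle_sum_uminus[OF G] cycle_sum_odd_eq[OF G sgn] right_minus_eq .
qed

end
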